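(* (In $\mathrm{BST}$.) Let $(M,d)$ be a standard metric space and let $w\in\mathbb{N}$ be unlimited. Let $(\widehat{M}_w,\widehat{D}_w)$ be the nonstandard hull of $(M,d)$ determined by $w$, as defined in the context. Then $(\widehat{M}_w,\widehat{D}_w)$ is a complete metric space.
   Context: **Theory $\mathrm{BST}$ (Bounded Set Theory).** Language: $\in$ and a unary predicate $\mathrm{st}$ ("is standard"). Quantifiers $\forall^{\mathrm{st}},\exists^{\mathrm{st}}$ range over standard sets, $\forall^{\mathrm{st\,fin}}$ over standard finite sets. An $\in$-formula is one not mentioning $\mathrm{st}$. Axioms: - all axioms of $\mathrm{ZFC}$ (Separation and Replacement only for $\in$-formulas); - Boundedness: $\forall x\,\exists^{\mathrm{st}}y\,(x\in y)$; - Transfer: $\forall^{\mathrm{st}}x\,\phi(x)\rightarrow\forall x\,\phi(x)$ for $\in$-formulas $\phi$ with standard parameters; - Standardization: $\forall A\,\exists^{\mathrm{st}}S\,\forall^{\mathrm{st}}x\,(x\in S\leftrightarrow x\in A\wedge\phi(x))$ for any $\mathrm{st}$-$\in$-formula $\phi$ with arbitrary parameters; - Bounded Idealization: for every standard $A$ and every $\in$-formula $\phi$ with arbitrary parameters, $\forall^{\mathrm{st\,fin}}a\subseteq A\,\exists y\,\forall x\in a\,\phi(x,y)\leftrightarrow\exists y\,\forall^{\mathrm{st}}x\in A\,\phi(x,y)$. **Notation.** For standard $A$ and any $\mathrm{st}$-$\in$-formula $\phi$, ${}^{\mathrm{st}}\{x\in A\mid\phi(x)\}$ is the unique standard set $S$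 with $\forall^{\mathrm{st}}x\,(x\in S\leftrightarrow x\in A\wedge\phi(x))$. A real $r$ is limited if $|r|<n$ for some standard $n\in\mathbb{N}$, unlimited otherwise; $r\simeq s$ means $|r-s|<1/n$ for all standard $n\in\mathbb{N}\setminus\{0\}$. For limited $r\in\mathbb{R}$, $\mathrm{sh}(r)$ is the unique standard real $\simeq r$. **Nonstandard hull.** Let $(M,d)$ be a standard metric space, $w\in\mathbb{N}$ unlimited. A point $x\in M$ is finite if $d(x,p)$ is limited for some (equivalently, all) standard $p\in M$. Define the standard set $B_w={}^{\mathrm{st}}\{f\in M^{\mathbb{N}}\mid f(w)\text{ is a finite point of }M\}$ and the standard relation $E_w={}^{\mathrm{st}}\{\langle f,g\rangle\in B_w\times B_w\mid d(f(w),g(w))\simeq0\}$, which is an equivalence relation on $B_w$. Let $D_w:B_w\times B_w\to\mathbb{R}$ be the unique standard function with $D_w(f,g)=\mathrm{sh}(d(f(w),g(w)))$ for all standard $f,g\in B_w$. Put $\widehat{M}_w=B_w/E_w$ and $\widehat{D}_w(f_{E_w},g_{E_w})=D_w(f,g)$, where $f_{E_w}$ is the equivalence class of $f$ modulo $E_w$ (this is well defined). *)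

theory Defs
  imports "HOL-Algebra.Ring"
begin

section \<open>The theory BST\<close>

text \<open>
  A model of BST is a type \<open>'v\<close> (the universe of all sets) with a binary relation and a unary
  predicate. By the completeness theorem, a sentence is provable in BST iff it holds in all models.
\<close>

class st_structure =
  fixes vmem :: "'a \<Rightarrow> 'a \<Rightarrow> bool"  (infix \<open>\<in>\<^sub>V\<close> 50)
    and st :: "'a \<Rightarrow> bool"

text \<open>
  First-order formulas, needed for the axiom schemas. Free variables other than the displayed
  ones play the role of parameters; their values are given by the valuation.
\<close>

datatype fm = Mem nat nat | Eql nat nat | Std nat | Neg fm | And fm fm | Forall nat fm

primrec sat :: "(nat \<Rightarrow> 'v::st_structure) \<Rightarrow> fm \<Rightarrow> bool" where
  "sat e (Mem i j) \<longleftrightarrow> e i \<in>\<^sub>V e j"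
| "sat e (Eql i j) \<longleftrightarrow> e i = e j"
| "sat e (Std i) \<longleftrightarrow> st (e i)"
| "sat e (Neg p) \<longleftrightarrow> \<not> sat e p"
| "sat e (And p q) \<longleftrightarrow> sat e p \<and> sat e q"
| "sat e (Forall i p) \<longleftrightarrow> (\<forall>x. sat (e(i := x)) p)"

primrec in_formula :: "fm \<Rightarrow> bool" where
  "in_formula (Mem i j) \<longleftrightarrow> True"
| "in_formula (Eql i j) \<longleftrightarrow> True"
| "in_formula (Std i) \<longleftrightarrow> False"
| "in_formula (Neg p) \<longleftrightarrow> in_formula p"
| "in_formula (And p q) \<longleftrightarrow> in_formula p \<and> in_formula q"
| "in_formula (Forall i p) \<longleftrightarrow> in_formula p"

definition sat1 :: "(nat \<Rightarrow> 'v::st_structure) \<Rightarrow> fm \<Rightarrow> 'v \<Rightarrow> bool" where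
  "sat1 e p x \<longleftrightarrow> sat (e(0 := x)) p"

definition sat2 :: "(nat \<Rightarrow> 'v::st_structure) \<Rightarrow> fm \<Rightarrow> 'v \<Rightarrow> 'v \<Rightarrow> bool" where
  "sat2 e p x y \<longleftrightarrow> sat (e(0 := x, 1 := y)) p"

definition elts :: "'v::st_structure \<Rightarrow> 'v set" where
  "elts A = {x. x \<in>\<^sub>V A}"

text \<open>The set of the model with the given extension; meaningful only if there is one.\<close>

definition vset :: "'v::st_structure set \<Rightarrow> 'v" where
  "vset X = (THE s. elts s = X)"

definition opair :: "'v::st_structure \<Rightarrow> 'v \<Rightarrow> 'v" where
  "opair x y = vset {vset {x}, vset {x, y}}"

definition cart :: "'v::st_structure \<Rightarrow> 'v \<Rightarrow> 'v" where
  "cart A B = vset {opair x y | x y. x \<in> elts A \<and> y \<in> elts B}"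

definition is_fun :: "'v::st_structure \<Rightarrow> 'v \<Rightarrow> 'v \<Rightarrow> bool" where
  "is_fun f A B \<longleftrightarrow> elts f \<subseteq> elts (cart A B) \<and> (\<forall>x\<in>elts A. \<exists>!y. opair x y \<in>\<^sub>V f)"

definition app :: "'v::st_structure \<Rightarrow> 'v \<Rightarrow> 'v" where
  "app f x = (THE y. opair x y \<in>\<^sub>V f)"

definition app2 :: "'v::st_structure \<Rightarrow> 'v \<Rightarrow> 'v \<Rightarrow> 'v" where
  "app2 f x y = app f (opair x y)"

definition funs :: "'v::st_structure \<Rightarrow> 'v \<Rightarrow> 'v" where
  "funs A B = vset {f. is_fun f A B}"

definition is_inductive :: "'v::st_structure \<Rightarrow> bool" where
  "is_inductive I \<longleftrightarrow> (\<exists>z\<in>elts I. elts z = {}) \<and>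
     (\<forall>x\<in>elts I. \<exists>y\<in>elts I. elts y = insert x (elts x))"

text \<open>Finiteness in the sense of the model: equinumerous to a von Neumann natural number.\<close>

definition vfinite :: "'v::st_structure \<Rightarrow> bool" where
  "vfinite a \<longleftrightarrow> (\<exists>n f. (\<forall>I. is_inductive I \<longrightarrow> n \<in>\<^sub>V I) \<and> is_fun f n a \<and>
     (\<forall>y\<in>elts a. \<exists>!x. x \<in>\<^sub>V n \<and> app f x = y))"

text \<open>
  In \<open>Transfer\<close> the valuation consists of standard sets; values of variables not occurring in
  the formula are irrelevant.
\<close>

class bst = st_structure +
  assumes Extensionality: "elts A = elts B \<Longrightarrow> A = B"
    and Foundation: "elts A \<noteq> {} \<Longrightarrow> \<exists>x\<in>elts A. elts x \<inter> elts A = {}"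
    and Pairing: "\<exists>P. elts P = {x, y}"
    and Union: "\<exists>U. elts U = (\<Union>x\<in>elts A. elts x)"
    and Power: "\<exists>P. elts P = {x. elts x \<subseteq> elts A}"
    and Infinity: "\<exists>I. is_inductive I"
    and Separation: "in_formula p \<Longrightarrow> \<exists>S. elts S = {x \<in> elts A. sat1 e p x}"
    and Replacement: "in_formula p \<Longrightarrow> \<forall>x\<in>elts A. \<exists>!y. sat2 e p x y \<Longrightarrow>
      \<exists>B. \<forall>x\<in>elts A. \<exists>y\<in>elts B. sat2 e p x y"
    and Choice: "\<forall>x\<in>elts A. elts x \<noteq> {} \<Longrightarrow>
      \<forall>x\<in>elts A. \<forall>y\<in>elts A. x \<noteq> y \<longrightarrow> elts x \<inter> elts y = {} \<Longrightarrow>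
      \<exists>C. \<forall>x\<in>elts A. \<exists>!z. z \<in> elts x \<inter> elts C"
    and Boundedness: "\<exists>y. st y \<and> x \<in>\<^sub>V y"
    and Transfer: "in_formula p \<Longrightarrow> \<forall>i. st (e i) \<Longrightarrow>
      \<forall>x. st x \<longrightarrow> sat1 e p x \<Longrightarrow> \<forall>x. sat1 e p x"
    and Standardization: "\<exists>S. st S \<and> (\<forall>x. st x \<longrightarrow> (x \<in>\<^sub>V S \<longleftrightarrow> x \<in>\<^sub>V A \<and> sat1 e p x))"
    and Bounded_Idealization: "in_formula p \<Longrightarrow> st A \<Longrightarrow>
      (\<forall>a. st a \<and> vfinite a \<and> elts a \<subseteq> elts A \<longrightarrow> (\<exists>y. \<forall>x\<in>elts a. sat2 e p x y)) \<longleftrightarrow>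
      (\<exists>y. \<forall>x\<in>elts A. st x \<longrightarrow> sat2 e p x y)"

text \<open>The set \<open>\<^sup>s\<^sup>t{x \<in> A | P x}\<close>; meaningful only if \<open>P\<close> is definable by an st-\<open>\<in>\<close>-formula.\<close>

definition stset :: "'v::st_structure \<Rightarrow> ('v \<Rightarrow> bool) \<Rightarrow> 'v" where
  "stset A P = (THE S. st S \<and> (\<forall>x. st x \<longrightarrow> (x \<in>\<^sub>V S \<longleftrightarrow> x \<in>\<^sub>V A \<and> P x)))"


section \<open>Real numbers inside the model\<close>

text \<open>
  The real line of the model is taken to be an arbitrary complete ordered field of the model:
  all components are sets of the model (operations and order as sets of pairs), and completeness
  refers to subsets belonging to the model.
\<close>

record 'v real_structure =
  rset :: 'v
  radd :: 'v
  rmul :: 'v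
  rzero :: 'v
  rone :: 'v
  rless :: 'v

definition ring_of :: "'v::st_structure real_structure \<Rightarrow> 'v ring" where
  "ring_of R = \<lparr>carrier = elts (rset R), monoid.mult = app2 (rmul R), one = rone R,
     zero = rzero R, add = app2 (radd R)\<rparr>"

definition lt :: "'v::st_structure real_structure \<Rightarrow> 'v \<Rightarrow> 'v \<Rightarrow> bool" where
  "lt R x y \<longleftrightarrow> opair x y \<in>\<^sub>V rless R"

definition le :: "'v::st_structure real_structure \<Rightarrow> 'v \<Rightarrow> 'v \<Rightarrow> bool" where
  "le R x y \<longleftrightarrow> lt R x y \<or> x = y"

definition complete_ordered_field :: "'v::st_structure real_structure \<Rightarrow> bool" where
  "complete_ordered_field R \<longleftrightarrow>
     is_fun (radd R) (cart (rset R) (rset R)) (rset R) \<and>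
     is_fun (rmul R) (cart (rset R) (rset R)) (rset R) \<and>
     elts (rless R) \<subseteq> elts (cart (rset R) (rset R)) \<and>
     field (ring_of R) \<and>
     (\<forall>x\<in>elts (rset R). \<not> lt R x x) \<and>
     (\<forall>x\<in>elts (rset R). \<forall>y\<in>elts (rset R). \<forall>z\<in>elts (rset R). lt R x y \<longrightarrow> lt R y z \<longrightarrow> lt R x z) \<and>
     (\<forall>x\<in>elts (rset R). \<forall>y\<in>elts (rset R). lt R x y \<or> x = y \<or> lt R y x) \<and>
     (\<forall>x\<in>elts (rset R). \<forall>y\<in>elts (rset R). \<forall>z\<in>elts (rset R). lt R x y \<longrightarrow>
        lt R (x \<oplus>\<^bsub>ring_of R\<^esub> z) (y \<oplus>\<^bsub>ring_of R\<^esub> z)) \<and>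
     (\<forall>x\<in>elts (rset R). \<forall>y\<in>elts (rset R). lt R \<zero>\<^bsub>ring_of R\<^esub> x \<longrightarrow> lt R \<zero>\<^bsub>ring_of R\<^esub> y \<longrightarrow>
        lt R \<zero>\<^bsub>ring_of R\<^esub> (x \<otimes>\<^bsub>ring_of R\<^esub> y)) \<and>
     (\<forall>S. elts S \<subseteq> elts (rset R) \<and> elts S \<noteq> {} \<and>
          (\<exists>b\<in>elts (rset R). \<forall>x\<in>elts S. le R x b) \<longrightarrow>
        (\<exists>s\<in>elts (rset R). (\<forall>x\<in>elts S. le R x s) \<and>
           (\<forall>b\<in>elts (rset R). (\<forall>x\<in>elts S. le R x b) \<longrightarrow> le R s b)))"

definition standard_reals :: "'v::st_structure real_structure \<Rightarrow> bool" where
  "standard_reals R \<longleftrightarrow> complete_ordered_field R \<and> st (rset R) \<and> st (radd R) \<and> st (rmul R) \<and>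
     st (rzero R) \<and> st (rone R) \<and> st (rless R)"

text \<open>The natural numbers, as a subset of the reals.\<close>

definition nats :: "'v::st_structure real_structure \<Rightarrow> 'v" where
  "nats R = vset {n \<in> elts (rset R). \<forall>I. elts I \<subseteq> elts (rset R) \<and> \<zero>\<^bsub>ring_of R\<^esub> \<in>\<^sub>V I \<and>
     (\<forall>x\<in>elts I. x \<oplus>\<^bsub>ring_of R\<^esub> \<one>\<^bsub>ring_of R\<^esub> \<in>\<^sub>V I) \<longrightarrow> n \<in>\<^sub>V I}"

definition rabs :: "'v::st_structure real_structure \<Rightarrow> 'v \<Rightarrow> 'v" where
  "rabs R x = (if lt R x \<zero>\<^bsub>ring_of R\<^esub> then \<ominus>\<^bsub>ring_of R\<^esub> x else x)"

definition limited :: "'v::st_structure real_structure \<Rightarrow> 'v \<Rightarrow> bool" where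
  "limited R r \<longleftrightarrow> (\<exists>n\<in>elts (nats R). st n \<and> lt R (rabs R r) n)"

definition approx :: "'v::st_structure real_structure \<Rightarrow> 'v \<Rightarrow> 'v \<Rightarrow> bool" where
  "approx R r s \<longleftrightarrow> (\<forall>n\<in>elts (nats R). st n \<and> n \<noteq> \<zero>\<^bsub>ring_of R\<^esub> \<longrightarrow>
     lt R (rabs R (r \<ominus>\<^bsub>ring_of R\<^esub> s)) (inv\<^bsub>ring_of R\<^esub> n))"

definition sh :: "'v::st_structure real_structure \<Rightarrow> 'v \<Rightarrow> 'v" where
  "sh R r = (THE s. s \<in>\<^sub>V rset R \<and> st s \<and> approx R s r)"


section \<open>Metric spaces inside the model\<close>

definition metric_space_in :: "'v::st_structure real_structure \<Rightarrow> 'v \<Rightarrow> 'v \<Rightarrow> bool" where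
  "metric_space_in R M d \<longleftrightarrow> is_fun d (cart M M) (rset R) \<and>
     (\<forall>x\<in>elts M. \<forall>y\<in>elts M. le R \<zero>\<^bsub>ring_of R\<^esub> (app2 d x y) \<and>
        (app2 d x y = \<zero>\<^bsub>ring_of R\<^esub> \<longleftrightarrow> x = y) \<and> app2 d x y = app2 d y x) \<and>
     (\<forall>x\<in>elts M. \<forall>y\<in>elts M. \<forall>z\<in>elts M.
        le R (app2 d x z) (app2 d x y \<oplus>\<^bsub>ring_of R\<^esub> app2 d y z))"

definition Cauchy_in :: "'v::st_structure real_structure \<Rightarrow> 'v \<Rightarrow> 'v \<Rightarrow> bool" where
  "Cauchy_in R d s \<longleftrightarrow> (\<forall>\<epsilon>\<in>elts (rset R). lt R \<zero>\<^bsub>ring_of R\<^esub> \<epsilon> \<longrightarrow>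
     (\<exists>k\<in>elts (nats R). \<forall>m\<in>elts (nats R). \<forall>n\<in>elts (nats R). le R k m \<and> le R k n \<longrightarrow>
        lt R (app2 d (app s m) (app s n)) \<epsilon>))"

definition converges_in :: "'v::st_structure real_structure \<Rightarrow> 'v \<Rightarrow> 'v \<Rightarrow> 'v \<Rightarrow> bool" where
  "converges_in R d s x \<longleftrightarrow> (\<forall>\<epsilon>\<in>elts (rset R). lt R \<zero>\<^bsub>ring_of R\<^esub> \<epsilon> \<longrightarrow>
     (\<exists>k\<in>elts (nats R). \<forall>n\<in>elts (nats R). le R k n \<longrightarrow> lt R (app2 d (app s n) x) \<epsilon>))"

definition complete_metric_space_in :: "'v::st_structure real_structure \<Rightarrow> 'v \<Rightarrow> 'v \<Rightarrow> bool" where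
  "complete_metric_space_in R M d \<longleftrightarrow> metric_space_in R M d \<and>
     (\<forall>s. is_fun s (nats R) M \<and> Cauchy_in R d s \<longrightarrow> (\<exists>x\<in>elts M. converges_in R d s x))"


section \<open>The nonstandard hull\<close>

definition finite_point :: "'v::st_structure real_structure \<Rightarrow> 'v \<Rightarrow> 'v \<Rightarrow> 'v \<Rightarrow> bool" where
  "finite_point R M d x \<longleftrightarrow> x \<in>\<^sub>V M \<and> (\<exists>p\<in>elts M. st p \<and> limited R (app2 d x p))"

definition hull_B :: "'v::st_structure real_structure \<Rightarrow> 'v \<Rightarrow> 'v \<Rightarrow> 'v \<Rightarrow> 'v" where
  "hull_B R M d w = stset (funs (nats R) M) (\<lambda>f. finite_point R M d (app f w))"

definition hull_E :: "'v::st_structure real_structure \<Rightarrow> 'v \<Rightarrow> 'v \<Rightarrow> 'v \<Rightarrow> 'v" where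
  "hull_E R M d w = stset (cart (hull_B R M d w) (hull_B R M d w))
     (\<lambda>t. \<exists>f g. t = opair f g \<and> approx R (app2 d (app f w) (app g w)) \<zero>\<^bsub>ring_of R\<^esub>)"

definition hull_D :: "'v::st_structure real_structure \<Rightarrow> 'v \<Rightarrow> 'v \<Rightarrow> 'v \<Rightarrow> 'v" where
  "hull_D R M d w = (THE D. st D \<and>
     is_fun D (cart (hull_B R M d w) (hull_B R M d w)) (rset R) \<and>
     (\<forall>f\<in>elts (hull_B R M d w). \<forall>g\<in>elts (hull_B R M d w). st f \<and> st g \<longrightarrow>
        app2 D f g = sh R (app2 d (app f w) (app g w))))"

definition hull_class :: "'v::st_structure real_structure \<Rightarrow> 'v \<Rightarrow> 'v \<Rightarrow> 'v \<Rightarrow> 'v \<Rightarrow> 'v" where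
  "hull_class R M d w f = vset {g \<in> elts (hull_B R M d w). opair f g \<in>\<^sub>V hull_E R M d w}"

definition hull_space :: "'v::st_structure real_structure \<Rightarrow> 'v \<Rightarrow> 'v \<Rightarrow> 'v \<Rightarrow> 'v" where
  "hull_space R M d w = vset (hull_class R M d w ` elts (hull_B R M d w))"

text \<open>As a set of pairs; being a function on the quotient is the well-definedness of the distance.\<close>

definition hull_dist :: "'v::st_structure real_structure \<Rightarrow> 'v \<Rightarrow> 'v \<Rightarrow> 'v \<Rightarrow> 'v" where
  "hull_dist R M d w = vset {opair (opair (hull_class R M d w f) (hull_class R M d w g))
       (app2 (hull_D R M d w) f g) | f g. f \<in>\<^sub>V hull_B R M d w \<and> g \<in>\<^sub>V hull_B R M d w}"

end

theory Submission imports Defs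
begin

text \<open>
  The distance between the classes of standard \<open>f\<close>, \<open>g\<close> is the shadow of \<open>d (f w) (g w)\<close>, so by
  Transfer \<open>D\<^sub>w\<close> is a pseudometric on \<open>B\<^sub>w\<close> whose zero set is \<open>E\<^sub>w\<close>. For completeness it suffices, again
  by Transfer, to find a limit of a standard Cauchy sequence \<open>F\<close> in \<open>B\<^sub>w\<close>. Call \<open>k\<close> good for \<open>n\<close> if
  \<open>d (F i n) (F j n) < D\<^sub>w (F i) (F j) + 1 / (i + 1)\<close> whenever \<open>i \<le> j \<le> k\<close>. Choose a standard \<open>g\<close>
  such that every \<open>g n\<close> equals \<open>F k n\<close> for some good \<open>k\<close> which is \<open>n\<close> or has a successor that is not
  good. Every standard \<open>k\<close> is good for \<open>w\<close>, so \<open>g w = F k w\<close> for a nonstandard good \<open>k\<close>, which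
  exceeds all standard \<open>i\<close>; hence \<open>F i w\<close> and \<open>g w\<close> are close for large standard \<open>i\<close>, and \<open>g\<close>
  represents the limit.
\<close>

section \<open>Definable predicates\<close>

text \<open>Transfer and Standardization are schemas over formulas, so each use needs a formula for
  the predicate at hand; hence a calculus of definability precedes the mathematics. The obstacle to
  completeness is that the points \<open>F i w\<close> are under control only for standard
  \<open>i\<close>: between standard members of the sequence \<open>D\<close> is the shadow of the
  distance at \<open>w\<close>, while for nonstandard indices nothing links the two. The diagonal
  \<open>g n = F n n\<close> would put the uncontrolled point \<open>F w w\<close> at
  \<open>w\<close>. Goodness cuts the diagonal off in time, by a condition whose parameters are all
  standard, so that \<open>g\<close> can be chosen standard. The slack 1 / (i + 1) has two jobs. For
  standard \<open>i\<close> it is a standard positive number, hence larger than the infinitesimal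
  error of the shadow. It also tends to 0, so that the condition for standard \<open>i\<close> and
  the nonstandard \<open>j = k\<close> forces closeness at \<open>w\<close>. The bound on
  \<open>D\<close> between \<open>F i\<close> and \<open>F k\<close> comes from Transfer: a standard
  Cauchy threshold serves all later indices, nonstandard ones included.\<close>

primrec ren :: "(nat \<Rightarrow> nat) \<Rightarrow> fm \<Rightarrow> fm" where
  "ren f (Mem i j) = Mem (f i) (f j)"
| "ren f (Eql i j) = Eql (f i) (f j)"
| "ren f (Std i) = Std (f i)"
| "ren f (Neg p) = Neg (ren f p)"
| "ren f (And p q) = And (ren f p) (ren f q)"
| "ren f (Forall i p) = Forall (f i) (ren f p)"

primrec var_bound :: "fm \<Rightarrow> nat" where
  "var_bound (Mem i j) = Suc (max i j)"
| "var_bound (Eql i j) = Suc (max i j)"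
| "var_bound (Std i) = Suc i"
| "var_bound (Neg p) = var_bound p"
| "var_bound (And p q) = max (var_bound p) (var_bound q)"
| "var_bound (Forall i p) = var_bound p"

lemma in_formula_ren [simp]: "in_formula (ren f p) = in_formula p"
  by (induction p) auto

text \<open>\<open>ren\<close> renames binders along with everything else and takes no care of
  capture. Injectivity makes this sound: updating the renamed variable then changes exactly one
  value of \<open>e \<circ> f\<close>.\<close>

lemma sat_ren:
  assumes "inj f"
  shows "sat e (ren f p) = sat (e \<circ> f) p"
proof (induction p arbitrary: e)
  case (Forall i p)
  have "(e(f i := x)) \<circ> f = (e \<circ> f)(i := x)" for x
    using assms by (auto simp: fun_eq_iff inj_eq)
  then show ?case by (simp only: Forall ren.simps sat.simps)
qed auto

lemma sat_cong: "(\<And>i. i < var_bound p \<Longrightarrow> e i = e' i) \<Longrightarrow> sat e p = sat e' p"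
proof (induction p arbitrary: e e')
  case (Forall i p)
  have "sat (e(i := x)) p = sat (e'(i := x)) p" for x
    by (rule Forall.IH) (use Forall.prems in auto)
  then show ?case by simp
next
  case (And p q)
  have "sat e p = sat e' p" "sat e q = sat e' q"
    by (rule And.IH; use And.prems in simp)+
  then show ?case by simp
next
  case (Neg p)
  have "sat e p = sat e' p" by (rule Neg.IH; use Neg.prems in simp)
  then show ?case by simp
qed auto

definition mix :: "(nat \<Rightarrow> 'v) \<Rightarrow> (nat \<Rightarrow> 'v) \<Rightarrow> nat \<Rightarrow> 'v" where
  "mix e c n = (if even n then e (n div 2) else c (n div 2))"

lemma mix_even [simp]: "mix e c (2 * n) = e n"
  by (simp add: mix_def)

text \<open>
  \<open>dfn a s G P\<close>: on valuations satisfying the guard \<open>G\<close>, the predicate \<open>P\<close> is given by a formula with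
  hidden parameters; \<open>a\<close> permits \<open>st\<close> in the formula and \<open>s\<close> forces the parameters to be standard.
  So Separation, Transfer and Standardization correspond to the flags \<open>False False\<close>, \<open>False True\<close>
  and \<open>True False\<close>. Valuations are de Bruijn contexts (a quantifier shifts them by one) and
  occupy the even variables, parameters the odd ones. The guard makes terms such as
  \<^term>\<open>app f x\<close> definable, which outside the domain of \<open>f\<close> are junk values of a definite description.
\<close>

definition dfn :: "bool \<Rightarrow> bool \<Rightarrow> ((nat \<Rightarrow> 'v::bst) \<Rightarrow> bool) \<Rightarrow> ((nat \<Rightarrow> 'v) \<Rightarrow> bool) \<Rightarrow> bool" where
  "dfn a s G P \<longleftrightarrow> (\<exists>p c. (a \<or> in_formula p) \<and> (s \<longrightarrow> (\<forall>i. st (c i))) \<and>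
     (\<forall>e. G e \<longrightarrow> (sat (mix e c) p \<longleftrightarrow> P e)))"

text \<open>The language has no function symbols, so a term enters through its graph: position 0
  holds the value, and the context of the term is shifted by one.\<close>

definition dtm :: "bool \<Rightarrow> bool \<Rightarrow> ((nat \<Rightarrow> 'v::bst) \<Rightarrow> bool) \<Rightarrow> ((nat \<Rightarrow> 'v) \<Rightarrow> 'v) \<Rightarrow> bool" where
  "dtm a s G t \<longleftrightarrow> dfn a s (\<lambda>e. G (\<lambda>n. e (Suc n))) (\<lambda>e. e 0 = t (\<lambda>n. e (Suc n)))"

section \<open>Closure rules for definable predicates and terms\<close>

lemma dfnI:
  assumes "a \<or> in_formula p" "\<And>i. s \<Longrightarrow> st (c i)" "\<And>e. G e \<Longrightarrow> sat (mix e c) p \<longleftrightarrow> P e"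
  shows "dfn a s G P"
  using assms unfolding dfn_def by blast

lemma dfn_cong:
  assumes "dfn a s G' P" "\<And>e. G e \<Longrightarrow> G' e" "\<And>e. G e \<Longrightarrow> P e \<longleftrightarrow> Q e"
  shows "dfn a s G Q"
  using assms unfolding dfn_def by (metis (no_types, lifting))

lemma dfn_guard: "dfn a s G' P \<Longrightarrow> (\<And>e. G e \<Longrightarrow> G' e) \<Longrightarrow> dfn a s G P"
  unfolding dfn_def by blast

text \<open>Supplies a filler for formulas without parameters: the odd variables must still get
  values, and standard ones when \<open>s\<close> holds.\<close>

lemma ex_st: "\<exists>x::'v::bst. st x"
  using Boundedness by blast

lemma dfn_ren:
  assumes "dfn a s G P" "inj f"
  shows "dfn a s (\<lambda>e. G (\<lambda>n. e (f n))) (\<lambda>e. P (\<lambda>n. e (f n)))"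
proof -
  from assms(1) obtain p c where p: "a \<or> in_formula p" "s \<longrightarrow> (\<forall>i. st (c i))"
    "\<And>e. G e \<Longrightarrow> sat (mix e c) p \<longleftrightarrow> P e" unfolding dfn_def by blast
  \<comment> \<open>Context position \<open>n\<close> is variable \<open>2 * n\<close>, so
    \<open>f\<close> acts on the even variables; the odd ones are fixed, which leaves the parameters
    in place.\<close>
  define g where "g n = (if even n then 2 * f (n div 2) else n)" for n
  have "inj g"
  proof (rule injI)
    fix x y assume *: "g x = g y"
    have "even (g n) \<longleftrightarrow> even n" for n by (simp add: g_def)
    with * have "even x = even y" by metis
    with * assms(2) show "x = y"
      by (cases "even x") (auto simp: g_def inj_eq elim!: evenE)
  qed
  moreover have "mix e c \<circ> g = mix (\<lambda>n. e (f n)) c" for e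
    by (auto simp: g_def mix_def fun_eq_iff)
  ultimately show ?thesis using p
    by (intro dfnI[of _ "ren g p" _ c]) (auto simp: sat_ren)
qed

text \<open>In the graph, position 0 is the value. The renaming therefore fixes 0 and skips position
  1, the new context entry that \<open>t\<close> ignores.\<close>

lemma dtm_shift:
  assumes "dtm a s G t"
  shows "dtm a s (\<lambda>e. G (\<lambda>n. e (Suc n))) (\<lambda>e. t (\<lambda>n. e (Suc n)))"
proof -
  have "inj (case_nat 0 (\<lambda>n. Suc (Suc n)))" by (auto simp: inj_def split: nat.splits)
  from dfn_ren[OF assms[unfolded dtm_def] this] show ?thesis by (simp add: dtm_def)
qed

lemma dfn_not: "dfn a s G P \<Longrightarrow> dfn a s G (\<lambda>e. \<not> P e)"
  unfolding dfn_def by (metis in_formula.simps(4) sat.simps(4))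

text \<open>Where \<open>P\<close> fails, the first conjunct settles the truth value; so a
  membership can guard an application that follows it. The two hidden parameter lists are
  interleaved: \<open>f\<close> sends parameter \<open>k\<close> of \<open>p\<close> to place
  \<open>2 * k\<close> of \<open>mix c d\<close>, and \<open>g\<close> that of \<open>q\<close> to
  place \<open>2 * k + 1\<close>.\<close>

lemma dfn_conj:
  assumes "dfn a s G P" "dfn a s (\<lambda>e. G e \<and> P e) Q"
  shows "dfn a s G (\<lambda>e. P e \<and> Q e)"
proof -
  from assms(1) obtain p c where p: "a \<or> in_formula p" "s \<longrightarrow> (\<forall>i. st (c i))"
    "\<And>e. G e \<Longrightarrow> sat (mix e c) p \<longleftrightarrow> P e" unfolding dfn_def by blast
  from assms(2) obtain q d where q: "a \<or> in_formula q" "s \<longrightarrow> (\<forall>i. st (d i))"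
    "\<And>e. G e \<and> P e \<Longrightarrow> sat (mix e d) q \<longleftrightarrow> Q e" unfolding dfn_def by blast
  define f where "f n = (if even n then n else 2 * n - 1)" for n :: nat
  define g where "g n = (if even n then n else 2 * n + 1)" for n :: nat
  have "inj f"
    by (rule inj_on_inverseI[where g = "\<lambda>m. if even m then m else (m + 1) div 2"])
      (auto simp: f_def elim!: oddE)
  moreover have "inj g"
    by (rule inj_on_inverseI[where g = "\<lambda>m. if even m then m else (m - 1) div 2"])
      (auto simp: g_def)
  moreover have "mix e (mix c d) \<circ> f = mix e c" for e
    by (auto simp: f_def mix_def fun_eq_iff elim!: oddE) (metis dvd_triv_left even_Suc)+
  moreover have "mix e (mix c d) \<circ> g = mix e d" for e
    by (auto simp: g_def mix_def fun_eq_iff elim!: oddE)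
  moreover have "s \<Longrightarrow> st (mix c d i)" for i
    using p(2) q(2) by (simp add: mix_def)
  ultimately show ?thesis using p q
    by (intro dfnI[of _ "And (ren f p) (ren g q)" _ "mix c d"]) (auto simp: sat_ren)
qed

lemma dfn_all:
  assumes "dfn a s (\<lambda>e. G (\<lambda>n. e (Suc n))) (\<lambda>e. P (e 0) (\<lambda>n. e (Suc n)))"
  shows "dfn a s G (\<lambda>e. \<forall>x. P x e)"
proof -
  from assms obtain p c where p: "a \<or> in_formula p" "s \<longrightarrow> (\<forall>i. st (c i))"
    "\<And>e. G (\<lambda>n. e (Suc n)) \<Longrightarrow> sat (mix e c) p \<longleftrightarrow> P (e 0) (\<lambda>n. e (Suc n))"
    unfolding dfn_def by blast
  define N where "N = var_bound p"
  define f where "f n = (if n = 0 then 2 * N else if even n \<and> n \<le> 2 * N then n - 2 else n)" for n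
  \<comment> \<open>The quantified variable moves to the fresh variable \<open>2 * N\<close>, the other context variables move down.\<close>
  have "inj f"
    by (rule inj_on_inverseI[where g = "\<lambda>m. if m = 2 * N then 0 else if even m \<and> m < 2 * N then m + 2 else m"])
      (auto simp: f_def elim!: evenE)
  have *: "sat ((mix e c)(2 * N := x) \<circ> f) p \<longleftrightarrow> P x e" if "G e" for e x
  proof -
    \<comment> \<open>The two valuations may differ at even variables above \<open>2 * N\<close>,
      which the renaming does not move; \<open>p\<close> has no variable that large.\<close>
    have "sat ((mix e c)(2 * N := x) \<circ> f) p = sat (mix (case_nat x e) c) p"
    proof (rule sat_cong)
      fix n assume "n < var_bound p"
      then show "((mix e c)(2 * N := x) \<circ> f) n = mix (case_nat x e) c n"
        by (auto simp: f_def mix_def N_def[symmetric] elim!: evenE split: nat.splits)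
    qed
    then show ?thesis using p(3)[of "case_nat x e"] that by simp
  qed
  show ?thesis using p(1,2) * \<open>inj f\<close>
    by (intro dfnI[of _ "Forall (2 * N) (ren f p)" _ c]) (auto simp: sat_ren)
qed

lemma dfn_mem0: "dfn a s G (\<lambda>e. e i \<in>\<^sub>V e j)"
  by (rule dfnI[of _ "Mem (2 * i) (2 * j)" _ "\<lambda>_. SOME x. st x"]) (auto simp: ex_st someI_ex)

lemma dfn_eq0: "dfn a s G (\<lambda>e. e i = e j)"
  by (rule dfnI[of _ "Eql (2 * i) (2 * j)" _ "\<lambda>_. SOME x. st x"]) (auto simp: ex_st someI_ex)

lemma dfn_st0: "dfn True s G (\<lambda>e. st (e i))"
  by (rule dfnI[of _ "Std (2 * i)" _ "\<lambda>_. SOME x. st x"]) (auto simp: ex_st someI_ex)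

lemma dtm_var: "dtm a s G (\<lambda>e. e i)"
  unfolding dtm_def by (rule dfn_eq0)

lemma dtm_const: "(s \<Longrightarrow> st c) \<Longrightarrow> dtm a s G (\<lambda>_. c)"
  unfolding dtm_def by (rule dfnI[of _ "Eql 0 1" _ "\<lambda>_. c"]) (auto simp: mix_def)

lemma dfn_imp:
  assumes "dfn a s G P" "dfn a s (\<lambda>e. G e \<and> P e) Q"
  shows "dfn a s G (\<lambda>e. P e \<longrightarrow> Q e)"
  using dfn_not[OF dfn_conj[OF assms(1) dfn_not[OF assms(2)]]] by simp

lemma dfn_disj:
  assumes "dfn a s G P" "dfn a s G Q"
  shows "dfn a s G (\<lambda>e. P e \<or> Q e)"
  using dfn_imp[OF dfn_not[OF assms(1)] dfn_guard[OF assms(2)]]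
  by (rule dfn_cong) auto

lemma dfn_iff:
  assumes "dfn a s G P" "dfn a s G Q"
  shows "dfn a s G (\<lambda>e. P e \<longleftrightarrow> Q e)"
proof -
  have "dfn a s G (\<lambda>e. (P e \<longrightarrow> Q e) \<and> (Q e \<longrightarrow> P e))"
    by (intro dfn_conj dfn_imp assms dfn_guard[OF assms(1)] dfn_guard[OF assms(2)]; simp)
  then show ?thesis by (rule dfn_cong) auto
qed

lemma dfn_ex:
  assumes "dfn a s (\<lambda>e. G (\<lambda>n. e (Suc n))) (\<lambda>e. P (e 0) (\<lambda>n. e (Suc n)))"
  shows "dfn a s G (\<lambda>e. \<exists>x. P x e)"
  using dfn_not[OF dfn_all[where P = "\<lambda>x e. \<not> P x e", OF dfn_not[OF assms]]] by simp

text \<open>\<open>P (t e) e\<close> is read as: every \<open>x\<close> equal to \<open>t e\<close>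
  satisfies \<open>P x e\<close>. The definition of \<open>P\<close> thus has to be correct only at
  the value of the term, and the guard may record that equation.\<close>

lemma dfn_subst:
  assumes "dfn a s (\<lambda>e. G (\<lambda>n. e (Suc n)) \<and> e 0 = t (\<lambda>n. e (Suc n))) (\<lambda>e. P (e 0) (\<lambda>n. e (Suc n)))"
    and "dtm a s G t"
  shows "dfn a s G (\<lambda>e. P (t e) e)"
  using dfn_all[where P = "\<lambda>x e. x = t e \<longrightarrow> P x e", OF dfn_imp[OF assms(2)[unfolded dtm_def] assms(1)]]
  by simp

lemma dfn_subst1:
  assumes "dfn a s (\<lambda>e. H (e 0)) (\<lambda>e. P (e 0))" and "dtm a s G t" and "\<And>e. G e \<Longrightarrow> H (t e)"
  shows "dfn a s G (\<lambda>e. P (t e))"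
  by (rule dfn_subst[where P = "\<lambda>x e. P x", OF dfn_guard[OF assms(1)] assms(2)]) (use assms(3) in auto)

lemma dtm_guard: "dtm a s G' t \<Longrightarrow> (\<And>e. G e \<Longrightarrow> G' e) \<Longrightarrow> dtm a s G t"
  unfolding dtm_def by (erule dfn_guard) auto

lemma dfn_subst2:
  assumes P: "dfn a s (\<lambda>e. H (e 0) (e 1)) (\<lambda>e. P (e 0) (e 1))"
    and t: "dtm a s G t" and u: "dtm a s G u" and H: "\<And>e. G e \<Longrightarrow> H (t e) (u e)"
  shows "dfn a s G (\<lambda>e. P (t e) (u e))"
proof -
  let ?G = "\<lambda>e. G (\<lambda>n. e (Suc n)) \<and> e 0 = u (\<lambda>n. e (Suc n))"
  let ?H = "\<lambda>e. ?G (\<lambda>n. e (Suc n)) \<and> e 0 = t (\<lambda>n. e (Suc (Suc n)))"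
  have "dtm a s ?G (\<lambda>e. t (\<lambda>n. e (Suc n)))"
    by (rule dtm_guard[OF dtm_shift[OF t]]) simp
  moreover have "dfn a s ?H (\<lambda>e. P (e 0) (e (Suc 0)))"
    by (rule dfn_guard[OF P[simplified]]) (use H in auto)
  ultimately have "dfn a s ?G (\<lambda>e. P (t (\<lambda>n. e (Suc n))) (e 0))"
    by (intro dfn_subst[where P = "\<lambda>x e. P x (e 0)" and G = ?G])
  from dfn_subst[where P = "\<lambda>y e. P (t e) y", OF this u] show ?thesis .
qed

lemma dfn_subst3:
  assumes "dfn a s (\<lambda>_. True) (\<lambda>e. P (e 0) (e 1) (e 2))"
    and t: "dtm a s G t" and u: "dtm a s G u" and v: "dtm a s G v"
  shows "dfn a s G (\<lambda>e. P (t e) (u e) (v e))"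
proof -
  let ?G = "\<lambda>e. G (\<lambda>n. e (Suc n)) \<and> e 0 = v (\<lambda>n. e (Suc n))"
  let ?H = "\<lambda>e. ?G (\<lambda>n. e (Suc n)) \<and> e 0 = u (\<lambda>n. e (Suc (Suc n)))"
  have "dtm a s ?G (\<lambda>e. u (\<lambda>n. e (Suc n)))"
    by (rule dtm_guard[OF dtm_shift[OF u]]) simp
  moreover have "dtm a s ?H (\<lambda>e. t (\<lambda>n. e (Suc (Suc n))))"
    by (rule dtm_guard[OF dtm_shift[OF dtm_shift[OF t]]]) simp
  moreover have "dfn a s G' (\<lambda>e. P (e 0) (e (Suc 0)) (e (Suc (Suc 0))))" for G'
    by (rule dfn_guard[OF assms(1)[simplified numeral_2_eq_2 One_nat_def]]) simp
  ultimately have "dfn a s ?H (\<lambda>e. P (t (\<lambda>n. e (Suc (Suc n)))) (e 0) (e (Suc 0)))"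
    by (intro dfn_subst[where P = "\<lambda>x e. P x (e 0) (e (Suc 0))" and G = ?H])
  from dfn_subst[where P = "\<lambda>y e. P (t (\<lambda>n. e (Suc n))) y (e 0)", OF this]
  have "dfn a s ?G (\<lambda>e. P (t (\<lambda>n. e (Suc n))) (u (\<lambda>n. e (Suc n))) (e 0))"
    using \<open>dtm a s ?G (\<lambda>e. u (\<lambda>n. e (Suc n)))\<close> by simp
  from dfn_subst[where P = "\<lambda>z e. P (t e) (u e) z", OF this v] show ?thesis .
qed

lemma dtm_subst2:
  assumes "\<And>G. dtm a s G (\<lambda>e. F (e 0) (e 1))" and "dtm a s G t" "dtm a s G u"
  shows "dtm a s G (\<lambda>e. F (t e) (u e))"
  unfolding dtm_def
  by (rule dfn_subst3[where P = "\<lambda>y x z. y = F x z", OF _ dtm_var dtm_shift[OF assms(2)] dtm_shift[OF assms(3)]])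
     (use assms(1)[unfolded dtm_def, of "\<lambda>_. True"] in \<open>simp add: numeral_2_eq_2\<close>)

lemma dfn_mem: "dtm a s G t \<Longrightarrow> dtm a s G u \<Longrightarrow> dfn a s G (\<lambda>e. t e \<in>\<^sub>V u e)"
  by (rule dfn_subst2[where H = "\<lambda>_ _. True" and P = "(\<in>\<^sub>V)", OF dfn_mem0]) auto

lemma dfn_eq: "dtm a s G t \<Longrightarrow> dtm a s G u \<Longrightarrow> dfn a s G (\<lambda>e. t e = u e)"
  by (rule dfn_subst2[where H = "\<lambda>_ _. True" and P = "(=)", OF dfn_eq0]) auto

lemma dfn_st: "dtm True s G t \<Longrightarrow> dfn True s G (\<lambda>e. st (t e))"
  by (rule dfn_subst1[where H = "\<lambda>_. True" and P = st, OF dfn_st0]) auto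

lemma mem_elts [simp]: "x \<in> elts A \<longleftrightarrow> x \<in>\<^sub>V A"
  by (simp add: elts_def)

lemma dfn_elts: "dtm a s G t \<Longrightarrow> dtm a s G u \<Longrightarrow> dfn a s G (\<lambda>e. t e \<in> elts (u e))"
  by (simp add: dfn_mem)

text \<open>The guard of the body records the membership of the bound variable. This is how
  \<open>app f x\<close> becomes definable under a quantifier over the domain of
  \<open>f\<close>.\<close>

lemma dfn_ball:
  assumes "dtm a s G A"
    and "dfn a s (\<lambda>e. G (\<lambda>n. e (Suc n)) \<and> e 0 \<in>\<^sub>V A (\<lambda>n. e (Suc n))) (\<lambda>e. P (e 0) (\<lambda>n. e (Suc n)))"
  shows "dfn a s G (\<lambda>e. \<forall>x\<in>elts (A e). P x e)"
  unfolding Ball_def mem_elts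
  by (rule dfn_all, rule dfn_imp, rule dfn_mem, rule dtm_var, rule dtm_shift[OF assms(1)], rule assms(2))

lemma dfn_bex:
  assumes "dtm a s G A"
    and "dfn a s (\<lambda>e. G (\<lambda>n. e (Suc n)) \<and> e 0 \<in>\<^sub>V A (\<lambda>n. e (Suc n))) (\<lambda>e. P (e 0) (\<lambda>n. e (Suc n)))"
  shows "dfn a s G (\<lambda>e. \<exists>x\<in>elts (A e). P x e)"
  unfolding Bex_def mem_elts
  by (rule dfn_ex, rule dfn_conj, rule dfn_mem, rule dtm_var, rule dtm_shift[OF assms(1)], rule assms(2))

text \<open>Definability proofs apply these rules from the outside in. Side conditions remain:
  guards of applications, and standardness of constants when \<open>s\<close> holds.\<close>

lemmas dfn_rules0 = dfn_not dfn_conj dfn_disj dfn_imp dfn_iff dfn_ball dfn_bex dfn_all dfn_ex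
  dfn_elts dfn_mem dfn_eq dfn_st dtm_var

lemma dfn_subset: "dtm a s G t \<Longrightarrow> dtm a s G u \<Longrightarrow> dfn a s G (\<lambda>e. elts (t e) \<subseteq> elts (u e))"
  unfolding subset_eq
  by (rule dfn_subst2[where H = "\<lambda>_ _. True"]; (rule dfn_rules0 | assumption | simp)+)

section \<open>Separation, Transfer and Standardization for definable predicates\<close>

lemma mix_upd: "(mix e c)(0 := x) = mix (e(0 := x)) c"
  by (auto simp: mix_def fun_eq_iff elim!: evenE)

lemma separation:
  assumes "dfn False False (\<lambda>e. e 0 \<in>\<^sub>V A) (\<lambda>e. P (e 0))"
  shows "\<exists>S. elts S = {x. x \<in>\<^sub>V A \<and> P x}"
proof -
  from assms obtain p c where p: "in_formula p"
    "\<And>e. e 0 \<in>\<^sub>V A \<Longrightarrow> sat (mix e c) p \<longleftrightarrow> P (e 0)" unfolding dfn_def by auto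
  have "x \<in>\<^sub>V A \<Longrightarrow> sat1 (mix c c) p x \<longleftrightarrow> P x" for x
    using p(2)[of "c(0 := x)"] by (simp add: sat1_def mix_upd)
  then show ?thesis using Separation[OF p(1), of A "mix c c"] by (metis (no_types, lifting) Collect_cong mem_elts)
qed

lemma st_all:
  assumes "dfn False True (\<lambda>_. True) (\<lambda>e. P (e 0))" "\<And>x. st x \<Longrightarrow> P x"
  shows "P x"
proof -
  from assms(1) obtain p c where p: "in_formula p" "\<forall>i. st (c i)"
    "\<And>e. sat (mix e c) p \<longleftrightarrow> P (e 0)" unfolding dfn_def by auto
  \<comment> \<open>\<open>Transfer\<close> asks for every value of the valuation to be standard, so
    the context too is filled with the standard parameters \<open>c\<close>; only position 0 matters
    to \<open>P\<close>.\<close>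
  have "sat1 (mix c c) p x \<longleftrightarrow> P x" for x
    using p(3)[of "c(0 := x)"] by (simp add: sat1_def mix_upd)
  moreover have "\<forall>i. st (mix c c i)" using p(2) by (simp add: mix_def)
  ultimately show ?thesis using Transfer[OF p(1), of "mix c c"] assms(2) by blast
qed

lemma st_ex:
  assumes "dfn False True (\<lambda>_. True) (\<lambda>e. P (e 0))" "P x"
  shows "\<exists>x. st x \<and> P x"
  using st_all[of "\<lambda>x. \<not> P x", OF dfn_not[OF assms(1)]] assms(2) by blast

text \<open>Relativization to a standard set admits predicates that are definable only on
  \<open>A\<close>, for instance because they apply functions with domain \<open>A\<close>.\<close>

lemma st_ball:
  assumes "dfn False True (\<lambda>e. e 0 \<in>\<^sub>V A) (\<lambda>e. P (e 0))" "st A"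
    and "\<And>x. st x \<Longrightarrow> x \<in>\<^sub>V A \<Longrightarrow> P x" and "x \<in>\<^sub>V A"
  shows "P x"
proof -
  have "dfn False True (\<lambda>_. True) (\<lambda>e. e 0 \<in>\<^sub>V A \<longrightarrow> P (e 0))"
    by (rule dfn_imp, rule dfn_mem, rule dtm_var, rule dtm_const) (use assms in simp_all)
  from st_all[of "\<lambda>x. x \<in>\<^sub>V A \<longrightarrow> P x", OF this] assms show ?thesis by blast
qed

lemma st_bex:
  assumes "dfn False True (\<lambda>e. e 0 \<in>\<^sub>V A) (\<lambda>e. P (e 0))" "st A" "x \<in>\<^sub>V A" "P x"
  shows "\<exists>x. st x \<and> x \<in>\<^sub>V A \<and> P x"
  using st_ball[of A "\<lambda>x. \<not> P x", OF dfn_not[OF assms(1)] assms(2)] assms(3,4) by blast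

text \<open>Transfer turns the existence of a set satisfying the formula for \<open>c\<close> into
  the existence of a standard one, and only \<open>c\<close> satisfies it.\<close>

lemma st_term: "dtm False True (\<lambda>_. True) (\<lambda>_. c) \<Longrightarrow> st c"
  using st_ex[of "\<lambda>x. x = c"] by (auto simp: dtm_def)

text \<open>Transfer for the equivalence of the two memberships. This is the uniqueness that gives
  the description in \<open>stset\<close> a value.\<close>

lemma st_set_eqI:
  fixes A B :: "'v::bst"
  assumes "st A" "st B" "\<And>x. st x \<Longrightarrow> x \<in>\<^sub>V A \<longleftrightarrow> x \<in>\<^sub>V B"
  shows "A = B"
proof -
  have "x \<in>\<^sub>V A \<longleftrightarrow> x \<in>\<^sub>V B" for x
    by (rule st_all[where P = "\<lambda>x. x \<in>\<^sub>V A \<longleftrightarrow> x \<in>\<^sub>V B"])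
      (rule dfn_rules0 dtm_const | simp add: assms)+
  then show ?thesis by (intro Extensionality) (auto simp: set_eq_iff)
qed

text \<open>Membership is settled for standard \<open>x\<close> only. Facts about nonstandard
  elements of \<open>stset A P\<close>, even that they lie in \<open>A\<close>, have to be derived
  from the standard ones by Transfer.\<close>

lemma standardization:
  assumes "dfn True False (\<lambda>e. e 0 \<in>\<^sub>V A) (\<lambda>e. P (e 0))"
  shows "st (stset A P)" and "st x \<Longrightarrow> x \<in>\<^sub>V stset A P \<longleftrightarrow> x \<in>\<^sub>V A \<and> P x"
proof -
  from assms obtain p c where p:
    "\<And>e. e 0 \<in>\<^sub>V A \<Longrightarrow> sat (mix e c) p \<longleftrightarrow> P (e 0)" unfolding dfn_def by auto
  have "x \<in>\<^sub>V A \<Longrightarrow> sat1 (mix c c) p x \<longleftrightarrow> P x" for x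
    using p[of "c(0 := x)"] by (simp add: sat1_def mix_upd)
  then obtain S where "st S \<and> (\<forall>x. st x \<longrightarrow> (x \<in>\<^sub>V S \<longleftrightarrow> x \<in>\<^sub>V A \<and> P x))"
    using Standardization[of A "mix c c" p] by blast
  moreover from this have "T = S" if "st T \<and> (\<forall>x. st x \<longrightarrow> (x \<in>\<^sub>V T \<longleftrightarrow> x \<in>\<^sub>V A \<and> P x))" for T
    using st_set_eqI[of T S] that by blast
  ultimately have "st (stset A P) \<and> (\<forall>x. st x \<longrightarrow> (x \<in>\<^sub>V stset A P \<longleftrightarrow> x \<in>\<^sub>V A \<and> P x))"
    unfolding stset_def by (rule theI)
  then show "st (stset A P)" and "st x \<Longrightarrow> x \<in>\<^sub>V stset A P \<longleftrightarrow> x \<in>\<^sub>V A \<and> P x" by auto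
qed

section \<open>Pairs, functions and choice\<close>

lemma elts_vset: "elts (S::'v::bst) = X \<Longrightarrow> elts (vset X) = X"
  unfolding vset_def by (rule theI[of _ S]) (auto dest: Extensionality)

lemma mem_vset: "elts (S::'v::bst) = X \<Longrightarrow> x \<in>\<^sub>V vset X \<longleftrightarrow> x \<in> X"
  using elts_vset mem_elts by metis

lemma set_ext: "(\<And>x. x \<in>\<^sub>V A \<longleftrightarrow> x \<in>\<^sub>V B) \<Longrightarrow> A = (B::'v::bst)"
  by (rule Extensionality) auto

lemma elts_opair [simp]: "elts (vset {x, y}) = {x, y::'v::bst}"
  using elts_vset[OF someI_ex[OF Pairing]] .

lemma elts_singleton [simp]: "elts (vset {x}) = {x::'v::bst}"
  using elts_opair[of x x] by simp

lemma opair_inject [simp]: "opair x y = opair x' y' \<longleftrightarrow> x = x' \<and> y = (y'::'v::bst)"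
proof
  assume "opair x y = opair x' y'"
  then have "elts (opair x y) = elts (opair x' y')" by simp
  then have *: "{vset {x}, vset {x, y}} = {vset {x'}, vset {x', y'}}" by (simp add: opair_def)
  then have "elts ` {vset {x}, vset {x, y}} = elts ` {vset {x'}, vset {x', y'}}" by (rule arg_cong)
  then have "{{x}, {x, y}} = {{x'}, {x', y'}}" by simp
  then show "x = x' \<and> y = y'" by (auto simp: doubleton_eq_iff)
qed simp

text \<open>Kuratowski's pair spelled out with membership alone, the form from which
  \<open>dtm_opair\<close> can be read off.\<close>

lemma opair_eq_iff: "z = opair x y \<longleftrightarrow> (\<forall>u. u \<in>\<^sub>V z \<longleftrightarrow>
    (\<forall>v. v \<in>\<^sub>V u \<longleftrightarrow> v = x) \<or> (\<forall>v. v \<in>\<^sub>V u \<longleftrightarrow> v = x \<or> v = (y::'v::bst)))"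
proof -
  have u: "u = vset {x} \<longleftrightarrow> (\<forall>v. v \<in>\<^sub>V u \<longleftrightarrow> v = x)" "u = vset {x, y} \<longleftrightarrow> (\<forall>v. v \<in>\<^sub>V u \<longleftrightarrow> v = x \<or> v = y)" for u
    using mem_elts[of _ "vset {x}"] mem_elts[of _ "vset {x, y}"] set_ext[of u "vset {x}"] set_ext[of u "vset {x, y}"]
    by (auto simp del: mem_elts)
  have "u \<in>\<^sub>V opair x y \<longleftrightarrow> u = vset {x} \<or> u = vset {x, y}" for u
    unfolding mem_elts[symmetric] opair_def by simp
  then show ?thesis unfolding u[symmetric] using set_ext[of z "opair x y"] by auto
qed

lemma dtm_opair: "dtm a s G t \<Longrightarrow> dtm a s G u \<Longrightarrow> dtm a s G (\<lambda>e. opair (t e) (u e))"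
  by (rule dtm_subst2[where F = opair]) (simp_all add: dtm_def opair_eq_iff, (rule dfn_rules0)+)

lemma ex_Un: "\<exists>U. elts U = elts A \<union> elts (B::'v::bst)"
  using Union[of "vset {A, B}"] by auto

text \<open>\<open>cart\<close> is meaningful only if some set has this extension. A pair {{x}, {x,
  y}} is a set of subsets of the union of \<open>A\<close> and \<open>B\<close>, so Separation can
  cut the product out of the double power set of that union.\<close>

lemma elts_cart: "elts (cart A B) = {opair x y | x y. x \<in>\<^sub>V A \<and> y \<in>\<^sub>V (B::'v::bst)}"
proof -
  obtain U where U: "elts U = elts A \<union> elts B" using ex_Un by blast
  obtain P where P: "elts P = {x. elts x \<subseteq> elts U}" using Power by blast
  obtain Q where Q: "elts Q = {x. elts x \<subseteq> elts P}" using Power by blast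
  have P': "x \<in>\<^sub>V P \<longleftrightarrow> elts x \<subseteq> elts U" and Q': "x \<in>\<^sub>V Q \<longleftrightarrow> elts x \<subseteq> elts P" for x
    using P Q by (auto simp flip: mem_elts)
  have "dfn False False (\<lambda>e. e 0 \<in>\<^sub>V Q) (\<lambda>e. \<exists>x\<in>elts A. \<exists>y\<in>elts B. e 0 = opair x y)"
    by (rule dfn_rules0 dtm_const dtm_opair | simp)+
  from separation[OF this] obtain S where
    S: "elts S = {z. z \<in>\<^sub>V Q \<and> (\<exists>x\<in>elts A. \<exists>y\<in>elts B. z = opair x y)}" by blast
  have "opair x y \<in>\<^sub>V Q" if "x \<in>\<^sub>V A" "y \<in>\<^sub>V B" for x y
  proof -
    have "vset {x} \<in>\<^sub>V P" "vset {x, y} \<in>\<^sub>V P" unfolding P' U using that by auto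
    then show ?thesis unfolding Q' opair_def by simp
  qed
  then have "elts S = {opair x y | x y. x \<in>\<^sub>V A \<and> y \<in>\<^sub>V B}" unfolding S by auto
  from elts_vset[OF this] show ?thesis by (simp add: cart_def)
qed

lemma mem_cart: "z \<in>\<^sub>V cart A B \<longleftrightarrow> (\<exists>x\<in>elts A. \<exists>y\<in>elts (B::'v::bst). z = opair x y)"
  unfolding mem_elts[symmetric, of z] elts_cart by auto

lemma opair_mem_cart [simp]: "opair x y \<in>\<^sub>V cart A B \<longleftrightarrow> x \<in>\<^sub>V A \<and> y \<in>\<^sub>V (B::'v::bst)"
  by (auto simp: mem_cart)

lemma cart_eq_iff:
  fixes z :: "'v::bst"
  shows "z = cart A B \<longleftrightarrow> (\<forall>u. u \<in>\<^sub>V z \<longleftrightarrow> (\<exists>x\<in>elts A. \<exists>y\<in>elts B. u = opair x y))"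
  unfolding mem_cart[symmetric] using set_ext by blast

lemma dtm_cart: "dtm a s G t \<Longrightarrow> dtm a s G u \<Longrightarrow> dtm a s G (\<lambda>e. cart (t e) (u e))"
  by (rule dtm_subst2[where F = cart])
    (simp_all add: dtm_def cart_eq_iff, (rule dfn_rules0 dtm_const dtm_opair)+)

lemmas dfn_rules = dtm_const dtm_opair dtm_cart dfn_rules0

section \<open>Functions as sets of pairs\<close>

lemma dfn_is_fun: "dtm a s G t \<Longrightarrow> dtm a s G u \<Longrightarrow> dtm a s G v \<Longrightarrow> dfn a s G (\<lambda>e. is_fun (t e) (u e) (v e))"
  by (rule dfn_subst3[where P = is_fun]) (unfold is_fun_def Ex1_def, (rule dfn_rules dfn_subset | simp)+)

lemma funs_mem: "f \<in>\<^sub>V funs A B \<longleftrightarrow> is_fun f A (B::'v::bst)"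
proof -
  obtain P where P: "elts P = {x. elts x \<subseteq> elts (cart A B)}" using Power by blast
  have "dfn False False (\<lambda>e. e 0 \<in>\<^sub>V P) (\<lambda>e. is_fun (e 0) A B)"
    by (rule dfn_rules dfn_is_fun | simp)+
  from separation[OF this] obtain S where S: "elts S = {f. f \<in>\<^sub>V P \<and> is_fun f A B}" by blast
  have "f \<in>\<^sub>V P" if "is_fun f A B" for f
    unfolding mem_elts[symmetric, of f] using that P by (simp add: is_fun_def)
  then have "elts S = {f. is_fun f A B}" unfolding S by blast
  from mem_vset[OF this] show ?thesis by (simp add: funs_def)
qed

lemma funs_eq_iff:
  fixes z :: "'v::bst"
  shows "z = funs A B \<longleftrightarrow> (\<forall>u. u \<in>\<^sub>V z \<longleftrightarrow> is_fun u A B)"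
  unfolding funs_mem[symmetric] using set_ext by blast

lemma dtm_funs: "dtm a s G t \<Longrightarrow> dtm a s G u \<Longrightarrow> dtm a s G (\<lambda>e. funs (t e) (u e))"
  by (rule dtm_subst2[where F = funs])
    (simp_all add: dtm_def funs_eq_iff, (rule dfn_rules dfn_is_fun)+)

definition defined_at :: "'v::bst \<Rightarrow> 'v \<Rightarrow> bool" where
  "defined_at f x \<longleftrightarrow> (\<exists>!y. opair x y \<in>\<^sub>V f)"

lemma defined_at: "is_fun f A B \<Longrightarrow> x \<in>\<^sub>V A \<Longrightarrow> defined_at f x"
  by (auto simp: is_fun_def defined_at_def)

lemma app_eq_iff: "defined_at f x \<Longrightarrow> y = app f x \<longleftrightarrow> opair x y \<in>\<^sub>V f"
  unfolding defined_at_def app_def by (metis the_equality)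

lemma app_eqI:
  fixes f :: "'v::bst"
  shows "is_fun f A B \<Longrightarrow> x \<in>\<^sub>V A \<Longrightarrow> opair x y \<in>\<^sub>V f \<Longrightarrow> app f x = y"
  using app_eq_iff defined_at by metis

lemma app_opair:
  fixes f :: "'v::bst"
  shows "is_fun f A B \<Longrightarrow> x \<in>\<^sub>V A \<Longrightarrow> opair x (app f x) \<in>\<^sub>V f"
  using app_eq_iff defined_at by metis

lemma app_mem:
  fixes f :: "'v::bst"
  shows "is_fun f A B \<Longrightarrow> x \<in>\<^sub>V A \<Longrightarrow> app f x \<in>\<^sub>V B"
  using app_opair[of f A B x] opair_mem_cart[of x "app f x" A B] by (auto simp: is_fun_def subset_eq simp del: opair_mem_cart)

lemma fun_mem_iff:
  fixes f :: "'v::bst"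
  shows "is_fun f A B \<Longrightarrow> t \<in>\<^sub>V f \<longleftrightarrow> (\<exists>x\<in>elts A. t = opair x (app f x))"
proof (rule iffI)
  assume f: "is_fun f A B" and t: "t \<in>\<^sub>V f"
  then have "t \<in>\<^sub>V cart A B" by (simp add: is_fun_def subset_eq)
  then obtain x y where "x \<in>\<^sub>V A" "t = opair x y" by (auto simp: mem_cart)
  then show "\<exists>x\<in>elts A. t = opair x (app f x)" using app_eqI[OF f, of x y] t by auto
next
  assume "is_fun f A B" and "\<exists>x\<in>elts A. t = opair x (app f x)"
  then show "t \<in>\<^sub>V f" using app_opair by auto
qed

lemma fun_eqI:
  fixes f :: "'v::bst"
  assumes "is_fun f A B" "is_fun g A B" "\<And>x. x \<in>\<^sub>V A \<Longrightarrow> app f x = app g x"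
  shows "f = g"
  by (rule set_ext) (use assms in \<open>simp add: fun_mem_iff\<close>)

lemma is_funI:
  fixes f :: "'v::bst"
  assumes "\<And>t. t \<in>\<^sub>V f \<Longrightarrow> t \<in>\<^sub>V cart A B" "\<And>x. x \<in>\<^sub>V A \<Longrightarrow> \<exists>y. opair x y \<in>\<^sub>V f"
    "\<And>x y z. opair x y \<in>\<^sub>V f \<Longrightarrow> opair x z \<in>\<^sub>V f \<Longrightarrow> y = z"
  shows "is_fun f A B"
  unfolding is_fun_def using assms by (auto simp: subset_eq)

lemma dtm_app:
  assumes f: "dtm a s G f" and x: "dtm a s G x" and "\<And>e. G e \<Longrightarrow> defined_at (f e) (x e)"
  shows "dtm a s G (\<lambda>e. app (f e) (x e))"
  unfolding dtm_def
  by (rule dfn_cong[OF dfn_mem[OF dtm_opair[OF dtm_shift[OF x] dtm_var] dtm_shift[OF f]]])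
     (use assms(3) in \<open>simp_all add: app_eq_iff\<close>)

lemma st_app:
  fixes f :: "'v::bst"
  assumes "is_fun f A B" "x \<in>\<^sub>V A" "st f" "st x"
  shows "st (app f x)"
  by (rule st_term, rule dtm_app) (use assms in \<open>auto intro: dtm_const defined_at\<close>)

lemma st_opair:
  fixes x :: "'v::bst"
  shows "st x \<Longrightarrow> st y \<Longrightarrow> st (opair x y)"
  by (rule st_term, rule dtm_opair) (auto intro: dtm_const)

lemma st_cart:
  fixes x :: "'v::bst"
  shows "st x \<Longrightarrow> st y \<Longrightarrow> st (cart x y)"
  by (rule st_term, rule dtm_cart) (auto intro: dtm_const)

lemma st_funs:
  fixes x :: "'v::bst"
  shows "st x \<Longrightarrow> st y \<Longrightarrow> st (funs x y)"
  by (rule st_term, rule dtm_funs) (auto intro: dtm_const)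

text \<open>The components are definable from the pair: Transfer yields a standard \<open>a\<close>
  that is the first component in some representation of the pair, and \<open>opair_inject\<close>
  identifies it with \<open>x\<close>.\<close>

lemma st_opairD:
  fixes x :: "'v::bst"
  assumes "st (opair x y)"
  shows "st x" "st y"
proof -
  have "\<exists>a. st a \<and> (\<exists>b. opair x y = opair a b)"
    by (rule st_ex[of _ x]) ((rule dfn_rules | simp add: assms)+)
  then show "st x" by auto
  have "\<exists>b. st b \<and> (\<exists>a. opair x y = opair a b)"
    by (rule st_ex[of _ y]) ((rule dfn_rules | simp add: assms)+)
  then show "st y" by auto
qed

text \<open>\<open>Choice\<close> provides transversals of disjoint families only. The family used
  consists of the sections of the relation, each the set of pairs of a fixed \<open>x\<close> with
  its admissible \<open>y\<close>; carrying \<open>x\<close> along makes them disjoint. What the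
  transversal shares with the relation is the graph of \<open>f\<close>.\<close>

lemma choice_fun:
  assumes P: "dfn False False (\<lambda>e. e 0 \<in>\<^sub>V A \<and> e 1 \<in>\<^sub>V B) (\<lambda>e. P (e 0) (e 1))"
    and ex: "\<And>x. x \<in>\<^sub>V A \<Longrightarrow> \<exists>y. y \<in>\<^sub>V B \<and> P x y"
  shows "\<exists>f. is_fun f A (B::'v::bst) \<and> (\<forall>x\<in>elts A. P x (app f x))"
proof -
  have P': "dfn False False G (\<lambda>e. P (t e) (u e))"
    if "dtm False False G t" "dtm False False G u" "\<And>e. G e \<Longrightarrow> t e \<in>\<^sub>V A" "\<And>e. G e \<Longrightarrow> u e \<in>\<^sub>V B" for t u G
    by (rule dfn_subst2[where H = "\<lambda>x y. x \<in>\<^sub>V A \<and> y \<in>\<^sub>V B", OF P that(1,2)]) (use that in auto)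
  define sec where "sec x z \<longleftrightarrow> (\<forall>t. t \<in>\<^sub>V z \<longleftrightarrow> (\<exists>y\<in>elts B. t = opair x y \<and> P x y))" for x z
  obtain Q where Q: "elts Q = {x. elts x \<subseteq> elts (cart A B)}" using Power by blast
  have "dfn False False (\<lambda>e. e 0 \<in>\<^sub>V Q) (\<lambda>e. \<exists>x\<in>elts A. sec x (e 0))"
    unfolding sec_def by (rule dfn_rules P' | simp)+
  from separation[OF this] obtain W where
    W: "elts W = {z. z \<in>\<^sub>V Q \<and> (\<exists>x\<in>elts A. sec x z)}" by blast
  have W: "z \<in>\<^sub>V W \<longleftrightarrow> z \<in>\<^sub>V Q \<and> (\<exists>x\<in>elts A. sec x z)" for z
    unfolding mem_elts[symmetric, of z W] W by simp
  have sec_ex: "\<exists>z\<in>elts W. sec x z" if x: "x \<in>\<^sub>V A" for x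
  proof -
    have "dfn False False (\<lambda>e. e 0 \<in>\<^sub>V cart A B) (\<lambda>e. \<exists>y\<in>elts B. e 0 = opair x y \<and> P x y)"
      by (rule dfn_rules P' | simp add: x)+
    from separation[OF this] obtain z where
      z: "elts z = {t. t \<in>\<^sub>V cart A B \<and> (\<exists>y\<in>elts B. t = opair x y \<and> P x y)}" by blast
    have "sec x z" unfolding sec_def mem_elts[symmetric, of _ z] z using x by auto
    moreover have "z \<in>\<^sub>V Q" using Q z by (auto simp flip: mem_elts[of z])
    ultimately show ?thesis using x by (intro bexI[of _ z]) (auto simp: W)
  qed
  have "\<exists>C. \<forall>x\<in>elts W. \<exists>!z. z \<in> elts x \<inter> elts C"
  proof (rule Choice)
    show "\<forall>x\<in>elts W. elts x \<noteq> {}"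
    proof
      fix z assume "z \<in> elts W"
      then obtain x where "x \<in>\<^sub>V A" "sec x z" by (auto simp: W)
      moreover from this obtain y where "y \<in>\<^sub>V B" "P x y" using ex by blast
      ultimately have "opair x y \<in>\<^sub>V z" by (auto simp: sec_def)
      then show "elts z \<noteq> {}" by (auto simp flip: mem_elts)
    qed
    show "\<forall>x\<in>elts W. \<forall>y\<in>elts W. x \<noteq> y \<longrightarrow> elts x \<inter> elts y = {}"
    proof (intro ballI impI, rule ccontr)
      fix z z' assume "z \<in> elts W" "z' \<in> elts W" "z \<noteq> z'" "elts z \<inter> elts z' \<noteq> {}"
      then obtain x x' t where *: "sec x z" "sec x' z'" "t \<in>\<^sub>V z" "t \<in>\<^sub>V z'" by (auto simp: W)
      then have "x = x'" unfolding sec_def by auto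
      with * have "z = z'" unfolding sec_def by (auto intro: set_ext)
      with \<open>z \<noteq> z'\<close> show False ..
    qed
  qed
  then obtain C where C: "\<And>z. z \<in>\<^sub>V W \<Longrightarrow> \<exists>!t. t \<in>\<^sub>V z \<and> t \<in>\<^sub>V C"
    unfolding Ball_def Int_iff mem_elts by blast
  have "dfn False False (\<lambda>e. e 0 \<in>\<^sub>V cart A B) (\<lambda>e. e 0 \<in>\<^sub>V C \<and> (\<exists>x\<in>elts A. \<exists>y\<in>elts B. e 0 = opair x y \<and> P x y))"
    by (rule dfn_rules P' | simp)+
  from separation[OF this] obtain f where
    f: "elts f = {t. t \<in>\<^sub>V cart A B \<and> t \<in>\<^sub>V C \<and> (\<exists>x\<in>elts A. \<exists>y\<in>elts B. t = opair x y \<and> P x y)}" by blast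
  have f_iff: "opair x y \<in>\<^sub>V f \<longleftrightarrow> x \<in>\<^sub>V A \<and> y \<in>\<^sub>V B \<and> opair x y \<in>\<^sub>V C \<and> P x y" for x y
    unfolding mem_elts[symmetric, of _ f] f by auto
  have fun_f: "is_fun f A B"
  proof (rule is_funI)
    show "t \<in>\<^sub>V cart A B" if "t \<in>\<^sub>V f" for t using that unfolding mem_elts[symmetric, of _ f] f by auto
    show "\<exists>y. opair x y \<in>\<^sub>V f" if "x \<in>\<^sub>V A" for x
      using sec_ex[OF that] C unfolding f_iff sec_def using that by (metis (no_types, lifting) mem_elts)
    show "y = z" if "opair x y \<in>\<^sub>V f" "opair x z \<in>\<^sub>V f" for x y z
    proof -
      have "x \<in>\<^sub>V A" using that f_iff by blast
      then obtain v where v: "v \<in>\<^sub>V W" "sec x v" using sec_ex[of x] by auto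
      then have "opair x y \<in>\<^sub>V v" "opair x z \<in>\<^sub>V v" using that f_iff by (auto simp: sec_def)
      then show ?thesis using C[OF v(1)] that f_iff by (metis opair_inject)
    qed
  qed
  have "P x (app f x)" if "x \<in>\<^sub>V A" for x
    using app_opair[OF fun_f that] f_iff by blast
  with fun_f show ?thesis by auto
qed

lemma dfn_weaken_params: "dfn False True G P \<Longrightarrow> dfn False False G P"
  unfolding dfn_def by blast

text \<open>That a choice function exists is itself an \<in>-statement with standard parameters, so
  Transfer replaces the function from \<open>choice_fun\<close> by a standard one.\<close>

lemma st_choice_fun:
  assumes P: "dfn False True (\<lambda>e. e 0 \<in>\<^sub>V A \<and> e 1 \<in>\<^sub>V B) (\<lambda>e. P (e 0) (e 1))"
    and ex: "\<And>x. x \<in>\<^sub>V A \<Longrightarrow> \<exists>y. y \<in>\<^sub>V B \<and> P x y" and "st A" "st B"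
  shows "\<exists>f. st f \<and> is_fun f A (B::'v::bst) \<and> (\<forall>x\<in>elts A. P x (app f x))"
proof -
  obtain f where "is_fun f A B \<and> (\<forall>x\<in>elts A. P x (app f x))"
    using choice_fun[OF dfn_weaken_params[OF P] ex] by blast
  moreover have P': "dfn False True G (\<lambda>e. P (t e) (u e))"
    if "dtm False True G t" "dtm False True G u" "\<And>e. G e \<Longrightarrow> t e \<in>\<^sub>V A \<and> u e \<in>\<^sub>V B" for t u G
    by (rule dfn_subst2[where H = "\<lambda>x y. x \<in>\<^sub>V A \<and> y \<in>\<^sub>V B", OF P that(1,2)]) (use that in auto)
  have "dfn False True (\<lambda>_. True) (\<lambda>e. is_fun (e 0) A B \<and> (\<forall>x\<in>elts A. P x (app (e 0) x)))"
    by (rule P' dfn_rules dfn_is_fun dtm_app | simp add: assms(3,4) defined_at app_mem; blast intro: defined_at app_mem assms(3,4))+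
  ultimately show ?thesis using st_ex[where P = "\<lambda>f. is_fun f A B \<and> (\<forall>x\<in>elts A. P x (app f x))"] by blast
qed

text \<open>Two nested applications of Transfer: once \<open>f\<close> is standard, it may serve as
  a parameter while \<open>g\<close> is transferred.\<close>

lemma st_ball2:
  fixes A C :: "'v::bst"
  assumes "st A" "st C" "f \<in>\<^sub>V A" "g \<in>\<^sub>V C"
    and "dfn False True (\<lambda>e. e 0 \<in>\<^sub>V A \<and> e 1 \<in>\<^sub>V C) (\<lambda>e. P (e 0) (e 1))"
    and "\<And>f g. st f \<Longrightarrow> st g \<Longrightarrow> f \<in>\<^sub>V A \<Longrightarrow> g \<in>\<^sub>V C \<Longrightarrow> P f g"
  shows "P f g"
proof -
  have P': "dfn False True G (\<lambda>e. P (t e) (u e))"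
    if "dtm False True G t" "dtm False True G u" "\<And>e. G e \<Longrightarrow> t e \<in>\<^sub>V A \<and> u e \<in>\<^sub>V C" for t u G
    by (rule dfn_subst2[where H = "\<lambda>x y. x \<in>\<^sub>V A \<and> y \<in>\<^sub>V C", OF assms(5) that(1,2)]) (use that in auto)
  have "\<forall>g\<in>elts C. P f g"
  proof (rule st_ball[where P = "\<lambda>f. \<forall>g\<in>elts C. P f g", OF _ assms(1) _ assms(3)])
    show "dfn False True (\<lambda>e. e 0 \<in>\<^sub>V A) (\<lambda>e. \<forall>g\<in>elts C. P (e 0) g)"
      by (rule P' dfn_rules | simp add: assms)+
    fix f assume f: "st f" "f \<in>\<^sub>V A"
    have "P f g" if g: "g \<in>\<^sub>V C" for g
      by (rule st_ball[where P = "\<lambda>g. P f g", OF _ assms(2) _ g]) (rule P' dfn_rules | simp add: assms(6) f)+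
    then show "\<forall>g\<in>elts C. P f g" by simp
  qed
  then show ?thesis using assms by simp
qed

section \<open>The real field of the model\<close>

locale bst_reals =
  fixes R :: "'v::bst real_structure" (structure)
  assumes standard_reals: "standard_reals R"
begin

lemma cof: "complete_ordered_field R"
  using standard_reals by (simp add: standard_reals_def)

lemma st_R: "st (rset R)" "st (radd R)" "st (rmul R)" "st (rzero R)" "st (rone R)" "st (rless R)"
  using standard_reals by (simp_all add: standard_reals_def)

sublocale F: field "ring_of R"
  using cof by (simp add: complete_ordered_field_def)

abbreviation K where "K \<equiv> rset R"
abbreviation plus (infixl \<open>\<oplus>R\<close> 65) where "x \<oplus>R y \<equiv> x \<oplus>\<^bsub>ring_of R\<^esub> y"
abbreviation times (infixl \<open>\<otimes>R\<close> 70) where "x \<otimes>R y \<equiv> x \<otimes>\<^bsub>ring_of R\<^esub> y"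
abbreviation neg where "neg x \<equiv> \<ominus>\<^bsub>ring_of R\<^esub> x"
abbreviation zer (\<open>\<zero>R\<close>) where "\<zero>R \<equiv> \<zero>\<^bsub>ring_of R\<^esub>"
abbreviation uni (\<open>\<one>R\<close>) where "\<one>R \<equiv> \<one>\<^bsub>ring_of R\<^esub>"
abbreviation lt_R (infix \<open>\<prec>\<close> 50) where "x \<prec> y \<equiv> lt R x y"
abbreviation le_R (infix \<open>\<preceq>\<close> 50) where "x \<preceq> y \<equiv> le R x y"
abbreviation N where "N \<equiv> nats R"

lemma carrier_R [simp]: "carrier (ring_of R) = elts K"
  by (simp add: ring_of_def)

lemma zero_R: "\<zero>R = rzero R" and one_R: "\<one>R = rone R"
  and add_R: "x \<oplus>R y = app (radd R) (opair x y)" and mult_R: "x \<otimes>R y = app (rmul R) (opair x y)"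
  by (simp_all add: ring_of_def app2_def)

lemma closed [simp]:
  "\<zero>R \<in>\<^sub>V K" "\<one>R \<in>\<^sub>V K" "x \<in>\<^sub>V K \<Longrightarrow> y \<in>\<^sub>V K \<Longrightarrow> x \<oplus>R y \<in>\<^sub>V K"
  "x \<in>\<^sub>V K \<Longrightarrow> y \<in>\<^sub>V K \<Longrightarrow> x \<otimes>R y \<in>\<^sub>V K" "x \<in>\<^sub>V K \<Longrightarrow> neg x \<in>\<^sub>V K"
  "x \<in>\<^sub>V K \<Longrightarrow> y \<in>\<^sub>V K \<Longrightarrow> x \<ominus>\<^bsub>ring_of R\<^esub> y \<in>\<^sub>V K"
  using F.zero_closed F.one_closed F.a_closed[of x y] F.m_closed[of x y] F.a_inv_closed[of x] F.minus_closed[of x y]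
  by simp_all

lemma is_fun_R: "is_fun (radd R) (cart K K) K" "is_fun (rmul R) (cart K K) K"
  using cof by (simp_all add: complete_ordered_field_def)

section \<open>Arithmetic of the ordered field\<close>

lemma order_axioms:
  "\<forall>x\<in>elts K. \<not> x \<prec> x"
  "\<forall>x\<in>elts K. \<forall>y\<in>elts K. \<forall>z\<in>elts K. x \<prec> y \<longrightarrow> y \<prec> z \<longrightarrow> x \<prec> z"
  "\<forall>x\<in>elts K. \<forall>y\<in>elts K. x \<prec> y \<or> x = y \<or> y \<prec> x"
  "\<forall>x\<in>elts K. \<forall>y\<in>elts K. \<forall>z\<in>elts K. x \<prec> y \<longrightarrow> x \<oplus>R z \<prec> y \<oplus>R z"
  "\<forall>x\<in>elts K. \<forall>y\<in>elts K. \<zero>R \<prec> x \<longrightarrow> \<zero>R \<prec> y \<longrightarrow> \<zero>R \<prec> x \<otimes>R y"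
  "\<forall>S. elts S \<subseteq> elts K \<and> elts S \<noteq> {} \<and> (\<exists>b\<in>elts K. \<forall>x\<in>elts S. x \<preceq> b) \<longrightarrow>
     (\<exists>s\<in>elts K. (\<forall>x\<in>elts S. x \<preceq> s) \<and> (\<forall>b\<in>elts K. (\<forall>x\<in>elts S. x \<preceq> b) \<longrightarrow> s \<preceq> b))"
  by (insert cof, unfold complete_ordered_field_def, (elim conjE, assumption)+)

lemma lt_irrefl: "x \<in>\<^sub>V K \<Longrightarrow> \<not> x \<prec> x"
  and lt_trans: "x \<prec> y \<Longrightarrow> y \<prec> z \<Longrightarrow> x \<in>\<^sub>V K \<Longrightarrow> y \<in>\<^sub>V K \<Longrightarrow> z \<in>\<^sub>V K \<Longrightarrow> x \<prec> z"
  and lt_total: "x \<in>\<^sub>V K \<Longrightarrow> y \<in>\<^sub>V K \<Longrightarrow> x \<prec> y \<or> x = y \<or> y \<prec> x"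
  and add_lt: "x \<prec> y \<Longrightarrow> x \<in>\<^sub>V K \<Longrightarrow> y \<in>\<^sub>V K \<Longrightarrow> z \<in>\<^sub>V K \<Longrightarrow> x \<oplus>R z \<prec> y \<oplus>R z"
  and mult_pos: "\<zero>R \<prec> x \<Longrightarrow> \<zero>R \<prec> y \<Longrightarrow> x \<in>\<^sub>V K \<Longrightarrow> y \<in>\<^sub>V K \<Longrightarrow> \<zero>R \<prec> x \<otimes>R y"
  using order_axioms(1) apply (simp)
  using order_axioms(2) apply (meson mem_elts)
  using order_axioms(3) apply (simp)
  using order_axioms(4) apply (simp)
  using order_axioms(5) apply (simp)
  done

lemma sup_ex:
  assumes "\<And>x. x \<in>\<^sub>V S \<Longrightarrow> x \<in>\<^sub>V K" "a \<in>\<^sub>V S" "b \<in>\<^sub>V K" "\<And>x. x \<in>\<^sub>V S \<Longrightarrow> x \<preceq> b"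
  shows "\<exists>s. s \<in>\<^sub>V K \<and> (\<forall>x\<in>elts S. x \<preceq> s) \<and> (\<forall>b\<in>elts K. (\<forall>x\<in>elts S. x \<preceq> b) \<longrightarrow> s \<preceq> b)"
proof -
  have "elts S \<subseteq> elts K" "elts S \<noteq> {}" "\<exists>b\<in>elts K. \<forall>x\<in>elts S. x \<preceq> b"
    using assms by (auto simp flip: mem_elts)
  from order_axioms(6)[rule_format, OF conjI[OF this(1) conjI[OF this(2,3)]]] show ?thesis by auto
qed

lemma le_refl [simp]: "x \<preceq> x" by (simp add: le_def)
lemma lt_imp_le: "x \<prec> y \<Longrightarrow> x \<preceq> y" by (simp add: le_def)
lemma le_trans: "x \<preceq> y \<Longrightarrow> y \<preceq> z \<Longrightarrow> x \<in>\<^sub>V K \<Longrightarrow> y \<in>\<^sub>V K \<Longrightarrow> z \<in>\<^sub>V K \<Longrightarrow> x \<preceq> z"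
  and le_lt_trans: "x \<preceq> y \<Longrightarrow> y \<prec> z \<Longrightarrow> x \<in>\<^sub>V K \<Longrightarrow> y \<in>\<^sub>V K \<Longrightarrow> z \<in>\<^sub>V K \<Longrightarrow> x \<prec> z"
  and lt_le_trans: "x \<prec> y \<Longrightarrow> y \<preceq> z \<Longrightarrow> x \<in>\<^sub>V K \<Longrightarrow> y \<in>\<^sub>V K \<Longrightarrow> z \<in>\<^sub>V K \<Longrightarrow> x \<prec> z"
  unfolding le_def using lt_trans by blast+
lemma not_lt: "x \<in>\<^sub>V K \<Longrightarrow> y \<in>\<^sub>V K \<Longrightarrow> \<not> x \<prec> y \<longleftrightarrow> y \<preceq> x"
  unfolding le_def using lt_trans lt_irrefl lt_total by blast
lemma le_antisym: "x \<preceq> y \<Longrightarrow> y \<preceq> x \<Longrightarrow> x \<in>\<^sub>V K \<Longrightarrow> y \<in>\<^sub>V K \<Longrightarrow> x = y"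
  unfolding le_def using lt_trans lt_irrefl by blast

lemma add_lt': "x \<prec> y \<Longrightarrow> x \<in>\<^sub>V K \<Longrightarrow> y \<in>\<^sub>V K \<Longrightarrow> z \<in>\<^sub>V K \<Longrightarrow> z \<oplus>R x \<prec> z \<oplus>R y"
  using add_lt[of x y z] by (simp add: F.a_comm)
lemma add_le: "x \<preceq> y \<Longrightarrow> x \<in>\<^sub>V K \<Longrightarrow> y \<in>\<^sub>V K \<Longrightarrow> z \<in>\<^sub>V K \<Longrightarrow> x \<oplus>R z \<preceq> y \<oplus>R z"
  and add_le': "x \<preceq> y \<Longrightarrow> x \<in>\<^sub>V K \<Longrightarrow> y \<in>\<^sub>V K \<Longrightarrow> z \<in>\<^sub>V K \<Longrightarrow> z \<oplus>R x \<preceq> z \<oplus>R y"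
  unfolding le_def using add_lt add_lt' by blast+
lemma add_lt_mono: "x \<prec> y \<Longrightarrow> u \<prec> v \<Longrightarrow> x \<in>\<^sub>V K \<Longrightarrow> y \<in>\<^sub>V K \<Longrightarrow> u \<in>\<^sub>V K \<Longrightarrow> v \<in>\<^sub>V K \<Longrightarrow> x \<oplus>R u \<prec> y \<oplus>R v"
  using lt_trans[OF add_lt[of x y u] add_lt'[of u v y]] by simp
lemma add_le_mono: "x \<preceq> y \<Longrightarrow> u \<preceq> v \<Longrightarrow> x \<in>\<^sub>V K \<Longrightarrow> y \<in>\<^sub>V K \<Longrightarrow> u \<in>\<^sub>V K \<Longrightarrow> v \<in>\<^sub>V K \<Longrightarrow> x \<oplus>R u \<preceq> y \<oplus>R v"
  using le_trans[OF add_le[of x y u] add_le'[of u v y]] by simp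
lemma add_lt_cancel: "x \<in>\<^sub>V K \<Longrightarrow> y \<in>\<^sub>V K \<Longrightarrow> z \<in>\<^sub>V K \<Longrightarrow> x \<oplus>R z \<prec> y \<oplus>R z \<longleftrightarrow> x \<prec> y"
  using add_lt[of x y z] add_lt[of y x z] lt_total[of x y] lt_irrefl[of "x \<oplus>R z"] lt_trans[of "x \<oplus>R z" "y \<oplus>R z" "x \<oplus>R z"]
  by auto
lemma lt_add_pos: "x \<in>\<^sub>V K \<Longrightarrow> y \<in>\<^sub>V K \<Longrightarrow> \<zero>R \<prec> y \<Longrightarrow> x \<prec> x \<oplus>R y"
  using add_lt'[of "\<zero>R" y x] by simp

lemma zero_lt_one: "\<zero>R \<prec> \<one>R"
proof (rule ccontr)
  assume not: "\<not> ?thesis"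
  then have "\<one>R \<prec> \<zero>R" using lt_total[of "\<zero>R" "\<one>R"] F.one_not_zero by auto
  from add_lt[OF this, of "neg \<one>R"] have *: "\<zero>R \<prec> neg \<one>R" by (simp add: F.r_neg)
  from mult_pos[OF this this] have "\<zero>R \<prec> \<one>R" by (simp add: F.l_minus F.r_minus)
  then show False using not by simp
qed

lemma mult_lt: "x \<prec> y \<Longrightarrow> \<zero>R \<prec> z \<Longrightarrow> x \<in>\<^sub>V K \<Longrightarrow> y \<in>\<^sub>V K \<Longrightarrow> z \<in>\<^sub>V K \<Longrightarrow> x \<otimes>R z \<prec> y \<otimes>R z"
proof -
  assume *: "x \<prec> y" "\<zero>R \<prec> z" "x \<in>\<^sub>V K" "y \<in>\<^sub>V K" "z \<in>\<^sub>V K"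
  then have "\<zero>R \<prec> y \<oplus>R neg x" using add_lt[of x y "neg x"] by (simp add: F.r_neg)
  then have "\<zero>R \<prec> (y \<oplus>R neg x) \<otimes>R z" using * by (intro mult_pos) auto
  then have "\<zero>R \<oplus>R x \<otimes>R z \<prec> (y \<oplus>R neg x) \<otimes>R z \<oplus>R x \<otimes>R z" using * by (intro add_lt) auto
  also have "(y \<oplus>R neg x) \<otimes>R z \<oplus>R x \<otimes>R z = y \<otimes>R z"
    using * by (simp add: F.l_distr F.l_minus F.a_assoc F.l_neg)
  finally show ?thesis using * by simp
qed

lemma inv_mem: "x \<in>\<^sub>V K \<Longrightarrow> x \<noteq> \<zero>R \<Longrightarrow> inv\<^bsub>ring_of R\<^esub> x \<in>\<^sub>V K"
  and inv_mult: "x \<in>\<^sub>V K \<Longrightarrow> x \<noteq> \<zero>R \<Longrightarrow> inv\<^bsub>ring_of R\<^esub> x \<otimes>R x = \<one>R"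
  using F.Units_inv_closed[of x] F.Units_l_inv[of x] by (simp_all add: F.field_Units)

lemma mult_one_pos:
  assumes "x \<in>\<^sub>V K" "y \<in>\<^sub>V K" "x \<otimes>R y = \<one>R" "\<zero>R \<prec> y"
  shows "\<zero>R \<prec> x"
proof (rule ccontr)
  assume "\<not> ?thesis"
  then have "x \<prec> \<zero>R \<or> x = \<zero>R" using lt_total[of x "\<zero>R"] assms by auto
  then have "x \<otimes>R y \<prec> \<zero>R \<or> x \<otimes>R y = \<zero>R" using mult_lt[of x "\<zero>R" y] assms by auto
  then show False using assms zero_lt_one lt_trans[of "\<zero>R" "\<one>R" "\<zero>R"] lt_irrefl[of "\<zero>R"] by auto
qed

text \<open>Here \<open>x\<close> is the reciprocal of \<open>y\<close> and \<open>v\<close> that of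
  \<open>u\<close>. Multiplying \<open>u \<prec> y\<close> by the positive
  \<open>x \<otimes>R v\<close> turns the two sides into \<open>x\<close> and
  \<open>v\<close>.\<close>

lemma mult_one_lt:
  assumes "x \<in>\<^sub>V K" "y \<in>\<^sub>V K" "x \<otimes>R y = \<one>R" "u \<in>\<^sub>V K" "v \<in>\<^sub>V K" "u \<otimes>R v = \<one>R" "\<zero>R \<prec> u" "u \<prec> y"
  shows "x \<prec> v"
proof -
  have y: "\<zero>R \<prec> y" using lt_trans assms closed by blast
  have x: "\<zero>R \<prec> x" using mult_one_pos assms y by blast
  have v: "\<zero>R \<prec> v" using mult_one_pos[of v u] assms F.m_comm[of u v] by simp
  have "u \<otimes>R (x \<otimes>R v) \<prec> y \<otimes>R (x \<otimes>R v)" using assms x v by (intro mult_lt mult_pos) auto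
  moreover have "u \<otimes>R (x \<otimes>R v) = (u \<otimes>R v) \<otimes>R x"
    using assms(1,4,5) F.m_assoc[of u v x] F.m_comm[of x v] by simp
  moreover have "y \<otimes>R (x \<otimes>R v) = (x \<otimes>R y) \<otimes>R v"
    using assms(1,2,5) F.m_assoc[of y x v] F.m_comm[of x y] by simp
  ultimately show ?thesis using assms by simp
qed

lemma inv_pos: "x \<in>\<^sub>V K \<Longrightarrow> \<zero>R \<prec> x \<Longrightarrow> \<zero>R \<prec> inv\<^bsub>ring_of R\<^esub> x"
proof -
  assume x: "x \<in>\<^sub>V K" "\<zero>R \<prec> x"
  then have nz: "x \<noteq> \<zero>R" using lt_irrefl by blast
  show ?thesis by (rule mult_one_pos[OF inv_mem[OF x(1) nz] x(1) inv_mult[OF x(1) nz] x(2)])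
qed

section \<open>Definability and standardness of the field operations\<close>

lemma dfn_lt: "dtm a s G t \<Longrightarrow> dtm a s G u \<Longrightarrow> dfn a s G (\<lambda>e. t e \<prec> u e)"
  unfolding lt_def by (rule dfn_mem, erule (1) dtm_opair, rule dtm_const, rule st_R)

lemma dfn_le: "dtm a s G t \<Longrightarrow> dtm a s G u \<Longrightarrow> dfn a s G (\<lambda>e. t e \<preceq> u e)"
  unfolding le_def by (rule dfn_disj, erule (1) dfn_lt, erule (1) dfn_eq)

lemma dtm_add: "dtm a s G t \<Longrightarrow> dtm a s G u \<Longrightarrow> (\<And>e. G e \<Longrightarrow> t e \<in>\<^sub>V K \<and> u e \<in>\<^sub>V K) \<Longrightarrow> dtm a s G (\<lambda>e. t e \<oplus>R u e)"
  unfolding add_R by (intro dtm_app dtm_opair dtm_const st_R defined_at[OF is_fun_R(1)]) auto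

lemma dtm_mult: "dtm a s G t \<Longrightarrow> dtm a s G u \<Longrightarrow> (\<And>e. G e \<Longrightarrow> t e \<in>\<^sub>V K \<and> u e \<in>\<^sub>V K) \<Longrightarrow> dtm a s G (\<lambda>e. t e \<otimes>R u e)"
  unfolding mult_R by (intro dtm_app dtm_opair dtm_const st_R defined_at[OF is_fun_R(2)]) auto

lemma st_zero: "st \<zero>R" and st_one: "st \<one>R" by (simp_all add: zero_R one_R st_R)

lemma st_add: "st x \<Longrightarrow> st y \<Longrightarrow> x \<in>\<^sub>V K \<Longrightarrow> y \<in>\<^sub>V K \<Longrightarrow> st (x \<oplus>R y)"
  unfolding add_R by (rule st_app[OF is_fun_R(1)]) (auto simp: st_R intro: st_opair)

lemma st_mult: "st x \<Longrightarrow> st y \<Longrightarrow> x \<in>\<^sub>V K \<Longrightarrow> y \<in>\<^sub>V K \<Longrightarrow> st (x \<otimes>R y)"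
  unfolding mult_R by (rule st_app[OF is_fun_R(2)]) (auto simp: st_R intro: st_opair)

lemmas dfn_R = dfn_lt dfn_le dtm_add dtm_mult dfn_rules

text \<open>Negation is not a component of the structure but the only solution of an equation.
  Transfer finds a standard solution, which must be \<open>neg x\<close>; \<open>st_inv\<close>
  works in the same way.\<close>

lemma st_neg:
  assumes "st x" "x \<in>\<^sub>V K"
  shows "st (neg x)"
proof -
  have "\<exists>y. st y \<and> y \<in>\<^sub>V K \<and> x \<oplus>R y = \<zero>R"
    by (rule st_bex[where x = "neg x"]) (rule dfn_R | simp add: assms st_R F.r_neg st_zero)+
  then obtain y where y: "st y" "y \<in>\<^sub>V K" "x \<oplus>R y = \<zero>R" by blast
  then have "y \<oplus>R x = \<zero>R" using assms(2) F.a_comm[of x y] by simp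
  then show ?thesis using F.minus_equality[of y x] assms(2) y(1,2) by simp
qed

lemma st_inv:
  assumes "st x" "x \<in>\<^sub>V K" "x \<noteq> \<zero>R"
  shows "st (inv\<^bsub>ring_of R\<^esub> x)"
proof -
  have "\<exists>y. st y \<and> y \<in>\<^sub>V K \<and> y \<otimes>R x = \<one>R"
    by (rule st_bex[where x = "inv\<^bsub>ring_of R\<^esub> x"]) (rule dfn_R | simp add: assms st_R inv_mult inv_mem st_one)+
  then obtain y where "st y" "y \<in>\<^sub>V K" "y \<otimes>R x = \<one>R" by blast
  moreover from this have "inv\<^bsub>ring_of R\<^esub> x = y"
    using F.inv_char[of x y] assms(2) F.m_comm[of x y] by simp
  ultimately show ?thesis by simp
qed

lemma half:
  assumes "st x" "x \<in>\<^sub>V K" "\<zero>R \<prec> x"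
  shows "\<exists>y. st y \<and> y \<in>\<^sub>V K \<and> \<zero>R \<prec> y \<and> y \<oplus>R y = x"
proof -
  let ?i = "inv\<^bsub>ring_of R\<^esub> (\<one>R \<oplus>R \<one>R)"
  have *: "\<zero>R \<prec> \<one>R \<oplus>R \<one>R" using lt_trans[OF zero_lt_one lt_add_pos[OF closed(2,2) zero_lt_one]] by simp
  then have nz: "\<one>R \<oplus>R \<one>R \<noteq> \<zero>R" using lt_irrefl[of "\<zero>R"] by auto
  have i: "?i \<in>\<^sub>V K" "st ?i" "\<zero>R \<prec> ?i"
    using inv_mem[OF _ nz] inv_pos[OF _ *] st_inv[OF st_add[OF st_one st_one] _ nz] by simp_all
  have "x \<otimes>R ?i \<oplus>R x \<otimes>R ?i = x \<otimes>R (?i \<otimes>R (\<one>R \<oplus>R \<one>R))"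
    using assms i by (simp add: F.r_distr)
  then show ?thesis using assms i inv_mult[OF _ nz] st_mult[of x ?i] mult_pos[of x ?i]
    by (intro exI[of _ "x \<otimes>R ?i"]) simp
qed

section \<open>Natural numbers, with internal and external induction\<close>

definition inductive_in :: "'v \<Rightarrow> bool" where
  "inductive_in I \<longleftrightarrow> elts I \<subseteq> elts K \<and> \<zero>R \<in>\<^sub>V I \<and> (\<forall>x\<in>elts I. x \<oplus>R \<one>R \<in>\<^sub>V I)"

lemma dfn_inductive_in: "dtm a s G t \<Longrightarrow> dfn a s G (\<lambda>e. inductive_in (t e))"
proof (rule dfn_subst1[where H = "\<lambda>_. True" and P = inductive_in])
  show "dfn a s (\<lambda>_. True) (\<lambda>e. inductive_in (e 0))"
    unfolding inductive_in_def
    by (rule dfn_R dfn_subset | auto simp: st_R st_zero st_one)+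
qed auto

lemma mem_nats: "n \<in>\<^sub>V N \<longleftrightarrow> n \<in>\<^sub>V K \<and> (\<forall>I. inductive_in I \<longrightarrow> n \<in>\<^sub>V I)"
proof -
  have "dfn False False (\<lambda>e. e 0 \<in>\<^sub>V K) (\<lambda>e. \<forall>I. inductive_in I \<longrightarrow> e 0 \<in>\<^sub>V I)"
    by (rule dfn_R dfn_inductive_in)+
  from separation[OF this] obtain S where
    "elts S = {n. n \<in>\<^sub>V K \<and> (\<forall>I. inductive_in I \<longrightarrow> n \<in>\<^sub>V I)}" by blast
  then have "elts S = {n \<in> elts K. \<forall>I. elts I \<subseteq> elts K \<and> \<zero>R \<in>\<^sub>V I \<and>
     (\<forall>x\<in>elts I. x \<oplus>R \<one>R \<in>\<^sub>V I) \<longrightarrow> n \<in>\<^sub>V I}" by (simp add: inductive_in_def)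
  from mem_vset[OF this] show ?thesis by (simp add: nats_def inductive_in_def)
qed

lemma nats_K [simp]: "n \<in>\<^sub>V N \<Longrightarrow> n \<in>\<^sub>V K"
  and zero_nats [simp]: "\<zero>R \<in>\<^sub>V N"
  and suc_nats [simp]: "n \<in>\<^sub>V N \<Longrightarrow> n \<oplus>R \<one>R \<in>\<^sub>V N"
  by (simp_all add: mem_nats) (auto simp: inductive_in_def)

text \<open>Internal induction: \<open>P\<close> may have nonstandard parameters, but its formula
  must avoid \<open>st\<close>, since Separation has to form the set of all \<open>n\<close>
  satisfying it.\<close>

lemma nat_induct:
  assumes P: "dfn False False (\<lambda>e. e 0 \<in>\<^sub>V N) (\<lambda>e. P (e 0))"
    and "P \<zero>R" and "\<And>n. n \<in>\<^sub>V N \<Longrightarrow> P n \<Longrightarrow> P (n \<oplus>R \<one>R)" and "n \<in>\<^sub>V N"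
  shows "P n"
proof -
  from separation[OF P] obtain I where I: "elts I = {n. n \<in>\<^sub>V N \<and> P n}" by blast
  have I': "x \<in>\<^sub>V I \<longleftrightarrow> x \<in>\<^sub>V N \<and> P x" for x unfolding mem_elts[symmetric, of _ I] I by simp
  have "inductive_in I" unfolding inductive_in_def subset_eq using assms(2,3) by (simp add: I')
  with assms(4) have "n \<in>\<^sub>V I" by (simp add: mem_nats)
  then show ?thesis by (simp add: I')
qed

lemma st_nats: "st N"
proof (rule st_term)
  have *: "z = N \<longleftrightarrow> (\<forall>n. n \<in>\<^sub>V z \<longleftrightarrow> n \<in>\<^sub>V K \<and> (\<forall>I. inductive_in I \<longrightarrow> n \<in>\<^sub>V I))" for z
    unfolding mem_nats[symmetric] using set_ext by blast
  show "dtm False True (\<lambda>_. True) (\<lambda>_. N)"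
    unfolding dtm_def * by (rule dfn_R dfn_inductive_in st_R)+
qed

lemma nat_nonneg: "n \<in>\<^sub>V N \<Longrightarrow> \<zero>R \<preceq> n"
proof (rule nat_induct[where P = "\<lambda>n. \<zero>R \<preceq> n"])
  show "dfn False False (\<lambda>e. e 0 \<in>\<^sub>V N) (\<lambda>e. \<zero>R \<preceq> e 0)" by (rule dfn_R | simp)+
  show "\<zero>R \<preceq> n \<oplus>R \<one>R" if "n \<in>\<^sub>V N" "\<zero>R \<preceq> n" for n
    using add_le_mono[of "\<zero>R" n "\<zero>R" "\<one>R"] that lt_imp_le[OF zero_lt_one] by simp
qed auto

lemma nat_cases:
  assumes "n \<in>\<^sub>V N"
  shows "n = \<zero>R \<or> (\<exists>m. m \<in>\<^sub>V N \<and> n = m \<oplus>R \<one>R)"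
proof -
  have "n = \<zero>R \<or> (\<exists>m\<in>elts N. n = m \<oplus>R \<one>R)"
    by (rule nat_induct[OF _ _ _ assms]) (rule dfn_R | auto)+
  then show ?thesis by auto
qed

lemma nat_suc_le:
  assumes "n \<in>\<^sub>V N" "i \<in>\<^sub>V N" "n \<prec> i"
  shows "n \<oplus>R \<one>R \<preceq> i"
proof -
  \<comment> \<open>The induction keeps \<open>i\<close> general, because the successor case applies
    the hypothesis to the predecessor of \<open>i\<close>.\<close>
  have "\<forall>i\<in>elts N. n \<prec> i \<longrightarrow> n \<oplus>R \<one>R \<preceq> i"
  proof (rule nat_induct[where P = "\<lambda>n. \<forall>i\<in>elts N. n \<prec> i \<longrightarrow> n \<oplus>R \<one>R \<preceq> i"])
    show "dfn False False (\<lambda>e. e 0 \<in>\<^sub>V N) (\<lambda>e. \<forall>i\<in>elts N. e 0 \<prec> i \<longrightarrow> e 0 \<oplus>R \<one>R \<preceq> i)"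
      by (rule dfn_R | simp)+
    show "\<forall>i\<in>elts N. \<zero>R \<prec> i \<longrightarrow> \<zero>R \<oplus>R \<one>R \<preceq> i"
    proof (intro ballI impI)
      fix i assume i: "i \<in> elts N" "\<zero>R \<prec> i"
      then obtain m where "m \<in>\<^sub>V N" "i = m \<oplus>R \<one>R"
        using nat_cases[of i] lt_irrefl[of "\<zero>R"] by auto
      then show "\<zero>R \<oplus>R \<one>R \<preceq> i" using nat_nonneg[of m] by (simp only: add_le closed nats_K)
    qed
    show "\<forall>i\<in>elts N. n \<oplus>R \<one>R \<prec> i \<longrightarrow> n \<oplus>R \<one>R \<oplus>R \<one>R \<preceq> i"
      if n: "n \<in>\<^sub>V N" and IH: "\<forall>i\<in>elts N. n \<prec> i \<longrightarrow> n \<oplus>R \<one>R \<preceq> i" for n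
    proof (intro ballI impI)
      fix i assume i: "i \<in> elts N" "n \<oplus>R \<one>R \<prec> i"
      have "\<zero>R \<preceq> n \<oplus>R \<one>R" using nat_nonneg n by simp
      then have "i \<noteq> \<zero>R" using i n not_lt[of "n \<oplus>R \<one>R" "\<zero>R"] by auto
      then obtain m where m: "m \<in>\<^sub>V N" "i = m \<oplus>R \<one>R" using nat_cases[of i] i by auto
      then have "n \<prec> m" using i n add_lt_cancel by simp
      then have "n \<oplus>R \<one>R \<preceq> m" using IH m by simp
      then show "n \<oplus>R \<one>R \<oplus>R \<one>R \<preceq> i" using m n by (simp only: add_le closed nats_K)
    qed
  qed (rule assms)
  then show ?thesis using assms by simp
qed

lemma lt_suc: "n \<in>\<^sub>V K \<Longrightarrow> n \<prec> n \<oplus>R \<one>R"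
  by (simp add: lt_add_pos zero_lt_one)

lemma archimedean:
  assumes "b \<in>\<^sub>V K"
  shows "\<exists>n. n \<in>\<^sub>V N \<and> b \<prec> n"
proof (rule ccontr)
  assume no: "\<not> ?thesis"
  then have "\<And>n. n \<in>\<^sub>V N \<Longrightarrow> n \<preceq> b" using not_lt[of b] assms by auto
  then obtain s where s: "s \<in>\<^sub>V K" "\<forall>n\<in>elts N. n \<preceq> s" "\<forall>b\<in>elts K. (\<forall>n\<in>elts N. n \<preceq> b) \<longrightarrow> s \<preceq> b"
    using sup_ex[of N "\<zero>R" b] assms by auto
  have "n \<preceq> s \<oplus>R neg \<one>R" if n: "n \<in>\<^sub>V N" for n
  proof -
    have "n \<oplus>R \<one>R \<preceq> s" using s n by simp
    from add_le[OF this, of "neg \<one>R"] s n show ?thesis by (simp add: F.a_assoc F.r_neg)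
  qed
  then have "s \<preceq> s \<oplus>R neg \<one>R" using s by simp
  from add_le[OF this, of "\<one>R"] s have "s \<oplus>R \<one>R \<preceq> s" by (simp add: F.a_assoc F.l_neg)
  then show False using lt_suc[OF s(1)] not_lt[of s "s \<oplus>R \<one>R"] s by simp
qed

lemma st_archimedean:
  assumes "b \<in>\<^sub>V K" "st b"
  shows "\<exists>n. st n \<and> n \<in>\<^sub>V N \<and> b \<prec> n"
proof -
  from archimedean[OF assms(1)] obtain n where "n \<in>\<^sub>V N" "b \<prec> n" by blast
  then show ?thesis by (intro st_bex) (rule dfn_R | simp add: st_nats assms)+
qed

text \<open>External induction, for predicates that may mention \<open>st\<close>. The standard set
  \<open>stset N P\<close> is closed under successor, first at its standard elements and then
  everywhere by Transfer. So \<open>nat_induct\<close> makes it contain all of \<open>N\<close>, and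
  its standard elements satisfy \<open>P\<close>.\<close>

lemma st_induct:
  assumes P: "dfn True False (\<lambda>e. e 0 \<in>\<^sub>V N) (\<lambda>e. P (e 0))"
    and "P \<zero>R" and "\<And>n. n \<in>\<^sub>V N \<Longrightarrow> st n \<Longrightarrow> P n \<Longrightarrow> P (n \<oplus>R \<one>R)" and "n \<in>\<^sub>V N" "st n"
  shows "P n"
proof -
  note S = standardization[OF P]
  let ?S = "stset N P"
  have step: "n \<in>\<^sub>V ?S \<longrightarrow> n \<oplus>R \<one>R \<in>\<^sub>V ?S" if "n \<in>\<^sub>V N" for n
  proof (rule st_ball[where P = "\<lambda>n. n \<in>\<^sub>V ?S \<longrightarrow> n \<oplus>R \<one>R \<in>\<^sub>V ?S", OF _ st_nats _ that])
    show "dfn False True (\<lambda>e. e 0 \<in>\<^sub>V N) (\<lambda>e. e 0 \<in>\<^sub>V ?S \<longrightarrow> e 0 \<oplus>R \<one>R \<in>\<^sub>V ?S)"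
      by (rule dfn_R | simp add: S(1) st_one)+
    show "n \<in>\<^sub>V ?S \<longrightarrow> n \<oplus>R \<one>R \<in>\<^sub>V ?S" if "st n" "n \<in>\<^sub>V N" for n
      using S(2)[of n] S(2)[of "n \<oplus>R \<one>R"] assms(3)[of n] that st_add[of n "\<one>R"] st_one by simp
  qed
  have "n \<in>\<^sub>V ?S"
    by (rule nat_induct[OF _ _ _ assms(4)])
      (use S(2)[of "\<zero>R"] assms(2) st_zero step in \<open>auto intro: dfn_mem dtm_var dtm_const\<close>)
  then show ?thesis using S(2) assms by blast
qed

text \<open>The claim mentions \<open>st\<close>, hence external induction on \<open>n\<close>. The
  only number up to \<open>n + 1\<close> that is not already up to \<open>n\<close> is
  \<open>n + 1\<close> itself, which is standard.\<close>

lemma nat_le_st: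
  assumes "n \<in>\<^sub>V N" "st n" "i \<in>\<^sub>V N" "i \<preceq> n"
  shows "st i"
proof -
  have "\<forall>i\<in>elts N. i \<preceq> n \<longrightarrow> st i"
  proof (rule st_induct[where P = "\<lambda>n. \<forall>i\<in>elts N. i \<preceq> n \<longrightarrow> st i"])
    show "dfn True False (\<lambda>e. e 0 \<in>\<^sub>V N) (\<lambda>e. \<forall>i\<in>elts N. i \<preceq> e 0 \<longrightarrow> st i)"
      by (rule dfn_R | simp)+
    show "\<forall>i\<in>elts N. i \<preceq> \<zero>R \<longrightarrow> st i"
    proof (intro ballI impI)
      fix i assume "i \<in> elts N" "i \<preceq> \<zero>R"
      then have "i = \<zero>R" using le_antisym[of i "\<zero>R"] nat_nonneg[of i] by simp
      then show "st i" using st_zero by simp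
    qed
    show "\<forall>i\<in>elts N. i \<preceq> n \<oplus>R \<one>R \<longrightarrow> st i"
      if n: "n \<in>\<^sub>V N" "st n" and IH: "\<forall>i\<in>elts N. i \<preceq> n \<longrightarrow> st i" for n
    proof (intro ballI impI)
      fix i assume i: "i \<in> elts N" "i \<preceq> n \<oplus>R \<one>R"
      show "st i"
      proof (cases "i \<preceq> n")
        case True then show ?thesis using IH i by simp
      next
        case False
        then have "n \<oplus>R \<one>R \<preceq> i" using nat_suc_le[of n i] not_lt[of n i] i n by auto
        then have "i = n \<oplus>R \<one>R" using le_antisym i n by simp
        then show ?thesis using st_add[of n "\<one>R"] n st_one by simp
      qed
    qed
  qed (rule assms)+
  then show ?thesis using assms by simp
qed

section \<open>Limited reals, infinitesimal closeness and shadows\<close>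

lemma rabs_nonneg: "\<zero>R \<preceq> r \<Longrightarrow> r \<in>\<^sub>V K \<Longrightarrow> rabs R r = r"
  unfolding rabs_def using not_lt[of r "\<zero>R"] by auto

lemma limited_iff:
  assumes "\<zero>R \<preceq> r" "r \<in>\<^sub>V K"
  shows "limited R r \<longleftrightarrow> (\<exists>b\<in>elts K. st b \<and> r \<prec> b)"
proof
  assume "limited R r"
  then show "\<exists>b\<in>elts K. st b \<and> r \<prec> b"
    by (auto simp: limited_def rabs_nonneg[OF assms])
next
  assume "\<exists>b\<in>elts K. st b \<and> r \<prec> b"
  then obtain b where b: "b \<in>\<^sub>V K" "st b" "r \<prec> b" by auto
  with st_archimedean obtain n where "st n" "n \<in>\<^sub>V N" "b \<prec> n" by blast
  with b lt_trans[of r b n] assms show "limited R r"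
    by (auto simp: limited_def rabs_nonneg[OF assms])
qed

text \<open>\<open>approx\<close> rewritten without absolute values and inverses, and with all
  standard positive reals in place of the numbers 1/n, so that the definability rules apply and
  errors can be halved.\<close>

definition apx :: "'v \<Rightarrow> 'v \<Rightarrow> bool" where
  "apx r s \<longleftrightarrow> (\<forall>\<epsilon>\<in>elts K. st \<epsilon> \<longrightarrow> \<zero>R \<prec> \<epsilon> \<longrightarrow> r \<prec> s \<oplus>R \<epsilon> \<and> s \<prec> r \<oplus>R \<epsilon>)"

lemma lt_minus_iff: "x \<in>\<^sub>V K \<Longrightarrow> y \<in>\<^sub>V K \<Longrightarrow> z \<in>\<^sub>V K \<Longrightarrow> x \<ominus>\<^bsub>ring_of R\<^esub> y \<prec> z \<longleftrightarrow> x \<prec> y \<oplus>R z"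
  using add_lt_cancel[of "x \<ominus>\<^bsub>ring_of R\<^esub> y" z y]
  by (simp add: F.minus_eq F.a_assoc F.l_neg F.a_comm[of y z])

lemma rabs_minus:
  assumes "r \<in>\<^sub>V K" "s \<in>\<^sub>V K" "e \<in>\<^sub>V K" "\<zero>R \<prec> e"
  shows "rabs R (r \<ominus>\<^bsub>ring_of R\<^esub> s) \<prec> e \<longleftrightarrow> r \<prec> s \<oplus>R e \<and> s \<prec> r \<oplus>R e"
proof (cases "r \<prec> s")
  case True
  then have "rabs R (r \<ominus>\<^bsub>ring_of R\<^esub> s) = s \<ominus>\<^bsub>ring_of R\<^esub> r"
    using lt_minus_iff[of r s "\<zero>R"] assms by (simp add: rabs_def F.minus_eq F.minus_add F.a_comm)
  moreover have "r \<prec> s \<oplus>R e" using True lt_add_pos[of s e] lt_trans[of r s "s \<oplus>R e"] assms by simp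
  ultimately show ?thesis using lt_minus_iff assms by simp
next
  case False
  then have "rabs R (r \<ominus>\<^bsub>ring_of R\<^esub> s) = r \<ominus>\<^bsub>ring_of R\<^esub> s"
    using lt_minus_iff[of r s "\<zero>R"] assms by (simp add: rabs_def)
  moreover have "s \<prec> r \<oplus>R e" using False not_lt[of r s] lt_add_pos[of r e] le_lt_trans[of s r "r \<oplus>R e"] assms by simp
  ultimately show ?thesis using lt_minus_iff assms by simp
qed

lemma approx_iff:
  assumes "r \<in>\<^sub>V K" "s \<in>\<^sub>V K"
  shows "approx R r s \<longleftrightarrow> apx r s"
proof
  assume a: "approx R r s"
  show "apx r s" unfolding apx_def
  proof (intro ballI impI)
    fix \<epsilon> assume e: "\<epsilon> \<in> elts K" "st \<epsilon>" "\<zero>R \<prec> \<epsilon>"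
    then have nz: "\<epsilon> \<noteq> \<zero>R" using lt_irrefl by auto
    define u where "u = inv\<^bsub>ring_of R\<^esub> \<epsilon>"
    have u: "u \<in>\<^sub>V K" "st u" "\<zero>R \<prec> u" "u \<otimes>R \<epsilon> = \<one>R"
      using inv_mem[OF _ nz] inv_pos st_inv[OF _ _ nz] inv_mult[OF _ nz] e by (simp_all add: u_def)
    from st_archimedean[OF u(1,2)] obtain n where n: "st n" "n \<in>\<^sub>V N" "u \<prec> n" by blast
    have "\<zero>R \<prec> n" using lt_trans[of "\<zero>R" u n] u n by simp
    then have n0: "n \<noteq> \<zero>R" using lt_irrefl by auto
    let ?i = "inv\<^bsub>ring_of R\<^esub> n"
    have i: "?i \<in>\<^sub>V K" "?i \<otimes>R n = \<one>R" using inv_mem[OF _ n0] inv_mult[OF _ n0] n by simp_all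
    have "\<zero>R \<prec> ?i" using inv_pos n \<open>\<zero>R \<prec> n\<close> by simp
    have "?i \<prec> \<epsilon>" using mult_one_lt[of ?i n u \<epsilon>] i u n e by simp
    have "rabs R (r \<ominus>\<^bsub>ring_of R\<^esub> s) \<prec> ?i" using a n n0 by (simp add: approx_def)
    then have "r \<prec> s \<oplus>R ?i \<and> s \<prec> r \<oplus>R ?i" using rabs_minus assms i \<open>\<zero>R \<prec> ?i\<close> by simp
    moreover have "s \<oplus>R ?i \<prec> s \<oplus>R \<epsilon>" "r \<oplus>R ?i \<prec> r \<oplus>R \<epsilon>"
      using add_lt'[OF \<open>?i \<prec> \<epsilon>\<close>] i e assms by simp_all
    ultimately show "r \<prec> s \<oplus>R \<epsilon> \<and> s \<prec> r \<oplus>R \<epsilon>"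
      using lt_trans[of r "s \<oplus>R ?i" "s \<oplus>R \<epsilon>"] lt_trans[of s "r \<oplus>R ?i" "r \<oplus>R \<epsilon>"] assms i e by simp
  qed
next
  assume a: "apx r s"
  show "approx R r s" unfolding approx_def
  proof (intro ballI impI)
    fix n assume n: "n \<in> elts N" "st n \<and> n \<noteq> \<zero>R"
    then have "\<zero>R \<prec> n" using nat_nonneg[of n] by (auto simp: le_def)
    then have i: "inv\<^bsub>ring_of R\<^esub> n \<in>\<^sub>V K" "\<zero>R \<prec> inv\<^bsub>ring_of R\<^esub> n" "st (inv\<^bsub>ring_of R\<^esub> n)"
      using inv_pos inv_mem st_inv n by simp_all
    then show "rabs R (r \<ominus>\<^bsub>ring_of R\<^esub> s) \<prec> inv\<^bsub>ring_of R\<^esub> n"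
      using a assms by (simp add: rabs_minus apx_def)
  qed
qed

lemma apx_sym: "apx r s \<Longrightarrow> apx s r" by (simp add: apx_def)

lemma apxD:
  assumes "apx r s" "st e" "e \<in>\<^sub>V K" "\<zero>R \<prec> e"
  shows "r \<prec> s \<oplus>R e" "s \<prec> r \<oplus>R e"
  using assms by (simp_all add: apx_def)

lemma half_lt:
  assumes "st x" "x \<in>\<^sub>V K" "\<zero>R \<prec> x"
  obtains y where "st y" "y \<in>\<^sub>V K" "\<zero>R \<prec> y" "y \<oplus>R y = x" "y \<prec> x"
  using half[OF assms] lt_add_pos by metis

lemma apx_trans:
  assumes "apx r s" "apx s t" "r \<in>\<^sub>V K" "s \<in>\<^sub>V K" "t \<in>\<^sub>V K"
  shows "apx r t"
  unfolding apx_def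
proof (intro ballI impI)
  fix e assume "e \<in> elts K" "st e" "\<zero>R \<prec> e"
  then obtain d where d: "st d" "d \<in>\<^sub>V K" "\<zero>R \<prec> d" "d \<oplus>R d = e" and e: "e \<in>\<^sub>V K" using half_lt[of e] by auto
  have *: "x \<prec> z \<oplus>R e" if "x \<prec> y \<oplus>R d" "y \<prec> z \<oplus>R d" "x \<in>\<^sub>V K" "y \<in>\<^sub>V K" "z \<in>\<^sub>V K" for x y z
    using add_lt[OF that(2), of d] lt_trans[OF that(1), of "z \<oplus>R d \<oplus>R d"] that d e by (simp add: F.a_assoc)
  show "r \<prec> t \<oplus>R e \<and> t \<prec> r \<oplus>R e"
    using * apxD[OF assms(1) d(1-3)] apxD[OF assms(2) d(1-3)] assms by blast
qed

text \<open>If \<open>s \<prec> r\<close>, then the standard positive number \<open>r\<close> minus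
  \<open>s\<close> is itself an admissible \<open>e\<close>, and it would give
  \<open>r \<prec> r\<close>.\<close>

lemma st_le_epsilon:
  assumes "st r" "st s" "r \<in>\<^sub>V K" "s \<in>\<^sub>V K"
    and "\<And>e. st e \<Longrightarrow> e \<in>\<^sub>V K \<Longrightarrow> \<zero>R \<prec> e \<Longrightarrow> r \<prec> s \<oplus>R e"
  shows "r \<preceq> s"
proof (rule ccontr)
  assume "\<not> r \<preceq> s"
  then have "s \<prec> r" using not_lt assms by blast
  then have "\<zero>R \<prec> r \<oplus>R neg s" using add_lt[of s r "neg s"] assms by (simp add: F.r_neg)
  then have "r \<prec> s \<oplus>R (r \<oplus>R neg s)" using assms by (simp add: st_add st_neg)
  moreover have "s \<oplus>R (r \<oplus>R neg s) = r" using assms F.a_comm[of r "neg s"] by (simp add: F.a_assoc[symmetric] F.r_neg)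
  ultimately show False using assms lt_irrefl by simp
qed

lemma apx_st_eq: "apx r s \<Longrightarrow> st r \<Longrightarrow> st s \<Longrightarrow> r \<in>\<^sub>V K \<Longrightarrow> s \<in>\<^sub>V K \<Longrightarrow> r = s"
  by (rule le_antisym; (rule st_le_epsilon)?) (auto dest: apxD)

text \<open>The shadow is the supremum of the standard set whose standard elements are the standard
  reals up to \<open>r\<close>. The bound \<open>b\<close> makes the supremum exist, and Transfer
  makes it standard.\<close>

lemma shadow_ex:
  assumes r: "r \<in>\<^sub>V K" "\<zero>R \<preceq> r" "b \<in>\<^sub>V K" "st b" "r \<prec> b"
  shows "\<exists>s. st s \<and> s \<in>\<^sub>V K \<and> apx s r"
proof -
  have "dfn True False (\<lambda>e. e 0 \<in>\<^sub>V K) (\<lambda>e. e 0 \<preceq> r)"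
    by (rule dfn_R | simp)+
  note S = standardization[OF this]
  define S where "S = stset K (\<lambda>x. x \<preceq> r)"
  have S: "st S" "\<And>x. st x \<Longrightarrow> x \<in>\<^sub>V S \<longleftrightarrow> x \<in>\<^sub>V K \<and> x \<preceq> r" using S by (simp_all add: S_def)
  have S_K: "x \<in>\<^sub>V K" if "x \<in>\<^sub>V S" for x
    by (rule st_ball[where P = "\<lambda>x. x \<in>\<^sub>V K", OF _ S(1) _ that]) (rule dfn_R | simp add: S st_R)+
  \<comment> \<open>Nonstandard elements of \<open>S\<close> may lie above \<open>r\<close>, so
    upper bounds of \<open>S\<close> are obtained by Transfer and are taken standard.\<close>
  have ub: "x \<preceq> c" if "x \<in>\<^sub>V S" "st c" "c \<in>\<^sub>V K" "r \<preceq> c" for x c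
  proof (rule st_ball[where P = "\<lambda>x. x \<preceq> c", OF _ S(1) _ that(1)])
    show "dfn False True (\<lambda>e. e 0 \<in>\<^sub>V S) (\<lambda>e. e 0 \<preceq> c)" by (rule dfn_R | simp add: that)+
    show "x \<preceq> c" if "st x" "x \<in>\<^sub>V S" for x using that S(2)[of x] \<open>r \<preceq> c\<close> le_trans r \<open>c \<in>\<^sub>V K\<close> by blast
  qed
  have "\<zero>R \<in>\<^sub>V S" using S st_zero r by simp
  then have "\<exists>s. s \<in>\<^sub>V K \<and> (\<forall>x\<in>elts S. x \<preceq> s) \<and> (\<forall>b\<in>elts K. (\<forall>x\<in>elts S. x \<preceq> b) \<longrightarrow> s \<preceq> b)"
    using sup_ex[of S "\<zero>R" b] S_K ub[of _ b] r lt_imp_le by blast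
  then obtain s0 where "s0 \<in>\<^sub>V K" "(\<forall>x\<in>elts S. x \<preceq> s0) \<and> (\<forall>b\<in>elts K. (\<forall>x\<in>elts S. x \<preceq> b) \<longrightarrow> s0 \<preceq> b)" by blast
  then have "\<exists>s. st s \<and> s \<in>\<^sub>V K \<and> (\<forall>x\<in>elts S. x \<preceq> s) \<and> (\<forall>b\<in>elts K. (\<forall>x\<in>elts S. x \<preceq> b) \<longrightarrow> s \<preceq> b)"
    by (intro st_bex) (rule dfn_R | simp add: S st_R)+
  then obtain s where s: "st s" "s \<in>\<^sub>V K" "\<And>x. x \<in>\<^sub>V S \<Longrightarrow> x \<preceq> s" "\<And>b. b \<in>\<^sub>V K \<Longrightarrow> (\<forall>x\<in>elts S. x \<preceq> b) \<Longrightarrow> s \<preceq> b"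
    by auto
  have "apx s r" unfolding apx_def
  proof (intro ballI impI conjI)
    fix e assume "e \<in> elts K" "st e" "\<zero>R \<prec> e"
    then obtain d where d: "st d" "d \<in>\<^sub>V K" "\<zero>R \<prec> d" "d \<prec> e" and e: "e \<in>\<^sub>V K" using half_lt[of e] by auto
    show "s \<prec> r \<oplus>R e"
    proof (rule ccontr)
      assume "\<not> s \<prec> r \<oplus>R e"
      then have "r \<oplus>R e \<preceq> s" using not_lt s r e by simp
      then have "r \<oplus>R d \<preceq> s" using add_lt'[OF d(4), of r] lt_le_trans[of "r \<oplus>R d" "r \<oplus>R e" s] d e r s lt_imp_le by simp
      from add_le[OF this, of "neg d"] have "r \<preceq> s \<oplus>R neg d" using r s d by (simp add: F.a_assoc F.r_neg)
      then have "\<forall>x\<in>elts S. x \<preceq> s \<oplus>R neg d" using ub s d by (simp add: st_add st_neg)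
      then have "s \<preceq> s \<oplus>R neg d" using s d by simp
      from add_le[OF this, of d] have "s \<oplus>R d \<preceq> s" using s d by (simp add: F.a_assoc F.l_neg)
      then show False using lt_add_pos[of s d] not_lt[of s "s \<oplus>R d"] s d by simp
    qed
    show "r \<prec> s \<oplus>R e"
    proof (rule ccontr)
      assume "\<not> r \<prec> s \<oplus>R e"
      then have "s \<oplus>R e \<preceq> r" using not_lt s r e by simp
      then have "s \<oplus>R e \<in>\<^sub>V S" using S(2) s e st_add \<open>st e\<close> by simp
      then have "s \<oplus>R e \<preceq> s" by (rule s(3))
      then show False using lt_add_pos[of s e] not_lt[of s "s \<oplus>R e"] s e \<open>\<zero>R \<prec> e\<close> by simp
    qed
  qed
  with s show ?thesis by blast
qed

lemma sh_eq:
  assumes "r \<in>\<^sub>V K" "st s" "s \<in>\<^sub>V K" "apx s r"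
  shows "sh R r = s"
  unfolding sh_def
proof (rule the_equality)
  show "s \<in>\<^sub>V K \<and> st s \<and> approx R s r" using assms by (simp add: approx_iff)
  show "t = s" if "t \<in>\<^sub>V K \<and> st t \<and> approx R t r" for t
  proof -
    from that assms have "apx t r" using approx_iff[of t r] by blast
    then have "apx t s" using apx_trans[of t r s] apx_sym[OF assms(4)] that assms by blast
    then show ?thesis using apx_st_eq[of t s] that assms by blast
  qed
qed

lemma dfn_apx: "dtm True s G t \<Longrightarrow> dtm True s G u \<Longrightarrow> (\<And>e. G e \<Longrightarrow> t e \<in>\<^sub>V K \<and> u e \<in>\<^sub>V K) \<Longrightarrow>
    dfn True s G (\<lambda>e. apx (t e) (u e))"
proof (rule dfn_subst2[where P = apx and H = "\<lambda>x y. x \<in>\<^sub>V K \<and> y \<in>\<^sub>V K"])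
  show "dfn True s (\<lambda>e. e 0 \<in>\<^sub>V K \<and> e 1 \<in>\<^sub>V K) (\<lambda>e. apx (e 0) (e 1))"
    unfolding apx_def by (rule dfn_R | simp add: st_R st_zero)+
qed auto

end

section \<open>The nonstandard hull\<close>

locale hull = bst_reals R for R :: "'v::bst real_structure" (structure) +
  fixes M d w :: 'v
  assumes metric: "metric_space_in R M d" and st_M: "st M" and st_d: "st d"
    and w_N: "w \<in>\<^sub>V N" and w_unlimited: "\<not> limited R w"
begin

abbreviation dist (\<open>\<d>\<close>) where "\<d> x y \<equiv> app2 d x y"

lemma is_fun_d: "is_fun d (cart M M) K"
  using metric by (simp add: metric_space_in_def)

lemma d_K [simp]: "x \<in>\<^sub>V M \<Longrightarrow> y \<in>\<^sub>V M \<Longrightarrow> \<d> x y \<in>\<^sub>V K"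
  unfolding app2_def by (rule app_mem[OF is_fun_d]) simp

lemma d_nonneg: "x \<in>\<^sub>V M \<Longrightarrow> y \<in>\<^sub>V M \<Longrightarrow> \<zero>R \<preceq> \<d> x y"
  and d_eq_0: "x \<in>\<^sub>V M \<Longrightarrow> y \<in>\<^sub>V M \<Longrightarrow> \<d> x y = \<zero>R \<longleftrightarrow> x = y"
  and d_sym: "x \<in>\<^sub>V M \<Longrightarrow> y \<in>\<^sub>V M \<Longrightarrow> \<d> x y = \<d> y x"
  and d_tri: "x \<in>\<^sub>V M \<Longrightarrow> y \<in>\<^sub>V M \<Longrightarrow> z \<in>\<^sub>V M \<Longrightarrow> \<d> x z \<preceq> \<d> x y \<oplus>R \<d> y z"
  using metric by (simp_all add: metric_space_in_def)

lemma dtm_d: "dtm a s G t \<Longrightarrow> dtm a s G u \<Longrightarrow> (\<And>e. G e \<Longrightarrow> t e \<in>\<^sub>V M \<and> u e \<in>\<^sub>V M) \<Longrightarrow> dtm a s G (\<lambda>e. \<d> (t e) (u e))"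
  unfolding app2_def by (intro dtm_app dtm_opair dtm_const st_d defined_at[OF is_fun_d]) auto

lemma w_not_st: "\<not> st w"
proof
  assume "st w"
  then have "st (w \<oplus>R \<one>R)" using st_add[of w "\<one>R"] st_one w_N by simp
  moreover have "w \<prec> w \<oplus>R \<one>R" using lt_suc w_N by simp
  moreover have "rabs R w = w" using rabs_nonneg[OF nat_nonneg[OF w_N]] w_N by simp
  ultimately show False using w_unlimited suc_nats[OF w_N] by (auto simp: limited_def)
qed

section \<open>The standard set of representatives\<close>

definition B where "B = hull_B R M d w"
definition D where "D = hull_D R M d w"
definition E where "E = hull_E R M d w"

lemma finite_point_iff:
  assumes "x \<in>\<^sub>V M"
  shows "finite_point R M d x \<longleftrightarrow> (\<exists>p\<in>elts M. st p \<and> (\<exists>b\<in>elts K. st b \<and> \<d> x p \<prec> b))"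
  using assms by (auto simp: finite_point_def limited_iff d_nonneg)

lemma app_w: "is_fun f N M \<Longrightarrow> app f w \<in>\<^sub>V M"
  using app_mem w_N by blast

lemma defined_w: "is_fun f N M \<Longrightarrow> defined_at f w"
  using defined_at w_N by blast

lemma hull_B: "st B" "st f \<Longrightarrow> f \<in>\<^sub>V B \<longleftrightarrow> is_fun f N M \<and> finite_point R M d (app f w)"
proof -
  have "dfn True False (\<lambda>e. e 0 \<in>\<^sub>V funs N M)
     (\<lambda>e. \<exists>p\<in>elts M. st p \<and> (\<exists>b\<in>elts K. st b \<and> \<d> (app (e 0) w) p \<prec> b))"
    by (rule dfn_R dtm_d dtm_app | simp add: funs_mem app_w defined_w)+
  then have "dfn True False (\<lambda>e. e 0 \<in>\<^sub>V funs N M) (\<lambda>e. finite_point R M d (app (e 0) w))"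
    by (rule dfn_cong) (auto simp: funs_mem finite_point_iff app_w)
  from standardization[OF this] show "st B" "st f \<Longrightarrow> f \<in>\<^sub>V B \<longleftrightarrow> is_fun f N M \<and> finite_point R M d (app f w)"
    by (simp_all add: B_def hull_B_def funs_mem)
qed

lemma B_fun: "f \<in>\<^sub>V B \<Longrightarrow> is_fun f N M"
proof -
  assume f: "f \<in>\<^sub>V B"
  have "f \<in>\<^sub>V funs N M"
    by (rule st_ball[where P = "\<lambda>f. f \<in>\<^sub>V funs N M", OF _ hull_B(1) _ f])
      (rule dfn_rules | simp add: st_funs st_nats st_M hull_B funs_mem)+
  then show ?thesis by (simp add: funs_mem)
qed

lemma B_app [simp]: "f \<in>\<^sub>V B \<Longrightarrow> n \<in>\<^sub>V N \<Longrightarrow> app f n \<in>\<^sub>V M"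
  using app_mem B_fun by blast

lemma B_app_w [simp]: "f \<in>\<^sub>V B \<Longrightarrow> app f w \<in>\<^sub>V M"
  using app_w B_fun by blast

text \<open>The path from \<open>app f w\<close> to \<open>app g w\<close> leads through the
  standard points \<open>p\<close> and \<open>q\<close> that witness finiteness, whose mutual
  distance is standard. The resulting bound is what \<open>shadow_ex\<close> asks for.\<close>

lemma B_bounded:
  assumes f: "st f" "f \<in>\<^sub>V B" and g: "st g" "g \<in>\<^sub>V B"
  shows "\<exists>b. b \<in>\<^sub>V K \<and> st b \<and> \<d> (app f w) (app g w) \<prec> b"
proof -
  obtain p b where p: "p \<in>\<^sub>V M" "st p" "b \<in>\<^sub>V K" "st b" "\<d> (app f w) p \<prec> b"
    using hull_B(2)[OF f(1)] f finite_point_iff[of "app f w"] by auto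
  obtain q c where q: "q \<in>\<^sub>V M" "st q" "c \<in>\<^sub>V K" "st c" "\<d> (app g w) q \<prec> c"
    using hull_B(2)[OF g(1)] g finite_point_iff[of "app g w"] by auto
  let ?x = "app f w" and ?y = "app g w"
  have xy: "?x \<in>\<^sub>V M" "?y \<in>\<^sub>V M" using f g by simp_all
  have "st (\<d> p q)" unfolding app2_def by (rule st_app[OF is_fun_d]) (simp_all add: p q st_d st_opair)
  have 1: "\<d> ?x ?y \<preceq> \<d> ?x p \<oplus>R \<d> p ?y" using d_tri xy p by simp
  have "\<d> p ?y \<preceq> \<d> p q \<oplus>R \<d> ?y q" using d_tri[of p q ?y] d_sym[of q ?y] xy p q by simp
  moreover have "\<d> p q \<oplus>R \<d> ?y q \<prec> \<d> p q \<oplus>R c" using add_lt' q p xy by simp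
  ultimately have "\<d> p ?y \<prec> \<d> p q \<oplus>R c" using le_lt_trans[of "\<d> p ?y" "\<d> p q \<oplus>R \<d> ?y q"] p q xy by simp
  then have "\<d> ?x p \<oplus>R \<d> p ?y \<prec> b \<oplus>R (\<d> p q \<oplus>R c)" using add_lt_mono[OF p(5)] p q xy by simp
  then have "\<d> ?x ?y \<prec> b \<oplus>R (\<d> p q \<oplus>R c)" using le_lt_trans[OF 1] p q xy by simp
  moreover have "st (b \<oplus>R (\<d> p q \<oplus>R c))" using \<open>st (\<d> p q)\<close> p q st_add by simp
  ultimately show ?thesis using p q by (intro exI[of _ "b \<oplus>R (\<d> p q \<oplus>R c)"]) simp
qed

text \<open>The graph comes by Standardization from the external relation that \<open>r\<close> is
  infinitely close to the distance at \<open>w\<close>. Totality rests on \<open>shadow_ex\<close>,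
  single-valuedness on \<open>apx_st_eq\<close>; both are shown for standard arguments and extended
  by Transfer.\<close>

lemma D_ex:
  "\<exists>D. st D \<and> is_fun D (cart B B) K \<and> (\<forall>f\<in>elts B. \<forall>g\<in>elts B. st f \<and> st g \<longrightarrow>
     st (app2 D f g) \<and> apx (app2 D f g) (\<d> (app f w) (app g w)))"
proof -
  define Q where "Q = cart (cart B B) K"
  define P where "P t \<longleftrightarrow> (\<exists>f\<in>elts B. \<exists>g\<in>elts B. \<exists>r\<in>elts K. t = opair (opair f g) r \<and> apx r (\<d> (app f w) (app g w)))" for t
  have "dfn True False (\<lambda>e. e 0 \<in>\<^sub>V Q) (\<lambda>e. P (e 0))"
    unfolding P_def by (rule dfn_apx dfn_R dtm_d dtm_app | simp add: defined_w[OF B_fun])+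
  note S = standardization[OF this]
  define S where "S = stset Q P"
  have stS: "st S" using S by (simp add: S_def)
  have S': "opair (opair f g) r \<in>\<^sub>V S \<longleftrightarrow> f \<in>\<^sub>V B \<and> g \<in>\<^sub>V B \<and> r \<in>\<^sub>V K \<and> apx r (\<d> (app f w) (app g w))"
    if "st f" "st g" "st r" for f g r
  proof -
    have "opair (opair f g) r \<in>\<^sub>V Q \<and> P (opair (opair f g) r) \<longleftrightarrow>
        f \<in>\<^sub>V B \<and> g \<in>\<^sub>V B \<and> r \<in>\<^sub>V K \<and> apx r (\<d> (app f w) (app g w))"
      by (auto simp: P_def Q_def)
    then show ?thesis using S(2)[of "opair (opair f g) r"] that by (simp add: S_def st_opair)
  qed
  have stQ: "st Q" "st (cart B B)" by (simp_all add: Q_def st_cart hull_B st_R)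
  have S_Q: "t \<in>\<^sub>V Q" if "t \<in>\<^sub>V S" for t
    by (rule st_ball[where P = "\<lambda>t. t \<in>\<^sub>V Q", OF _ stS _ that])
      (rule dfn_rules | use S(2) in \<open>simp add: stQ S_def\<close>)+
  have fun_S: "is_fun S (cart B B) K"
  proof (rule is_funI)
    show "t \<in>\<^sub>V cart (cart B B) K" if "t \<in>\<^sub>V S" for t using S_Q[OF that] by (simp add: Q_def)
    show "\<exists>r. opair p r \<in>\<^sub>V S" if "p \<in>\<^sub>V cart B B" for p
    proof (rule st_ball[where P = "\<lambda>p. \<exists>r. opair p r \<in>\<^sub>V S", OF _ stQ(2) _ that])
      show "dfn False True (\<lambda>e. e 0 \<in>\<^sub>V cart B B) (\<lambda>e. \<exists>r. opair (e 0) r \<in>\<^sub>V S)"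
        by (rule dfn_rules | simp add: stS)+
      fix p assume "st p" "p \<in>\<^sub>V cart B B"
      then obtain f g where fg: "p = opair f g" "f \<in>\<^sub>V B" "g \<in>\<^sub>V B" by (auto simp: mem_cart)
      then have fg': "st f" "st g" using st_opairD \<open>st p\<close> by blast+
      then obtain b where "b \<in>\<^sub>V K" "st b" "\<d> (app f w) (app g w) \<prec> b" using B_bounded fg by blast
      then obtain s where "st s" "s \<in>\<^sub>V K" "apx s (\<d> (app f w) (app g w))"
        using shadow_ex[of "\<d> (app f w) (app g w)" b] d_nonneg fg by auto
      then show "\<exists>r. opair p r \<in>\<^sub>V S" using S' fg fg' by blast
    qed
    \<comment> \<open>\<open>S'\<close> describes triples of standard sets only, so Transfer is used
      three times: for the argument \<open>p\<close> and for each of the two values.\<close>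
    have uniq: "\<forall>r r'. opair p r \<in>\<^sub>V S \<longrightarrow> opair p r' \<in>\<^sub>V S \<longrightarrow> r = r'" for p
    proof (rule st_all[where P = "\<lambda>p. \<forall>r r'. opair p r \<in>\<^sub>V S \<longrightarrow> opair p r' \<in>\<^sub>V S \<longrightarrow> r = r'"])
      show "dfn False True (\<lambda>_. True) (\<lambda>e. \<forall>r r'. opair (e 0) r \<in>\<^sub>V S \<longrightarrow> opair (e 0) r' \<in>\<^sub>V S \<longrightarrow> r = r')"
        by (rule dfn_rules | simp add: stS)+
      fix p :: 'v assume p: "st p"
      have "\<forall>r'. opair p r \<in>\<^sub>V S \<longrightarrow> opair p r' \<in>\<^sub>V S \<longrightarrow> r = r'" for r
      proof (rule st_all[where P = "\<lambda>r. \<forall>r'. opair p r \<in>\<^sub>V S \<longrightarrow> opair p r' \<in>\<^sub>V S \<longrightarrow> r = r'"])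
        show "dfn False True (\<lambda>_. True) (\<lambda>e. \<forall>r'. opair p (e 0) \<in>\<^sub>V S \<longrightarrow> opair p r' \<in>\<^sub>V S \<longrightarrow> e 0 = r')"
          by (rule dfn_rules | simp add: stS p)+
        fix r :: 'v assume r: "st r"
        show "\<forall>r'. opair p r \<in>\<^sub>V S \<longrightarrow> opair p r' \<in>\<^sub>V S \<longrightarrow> r = r'"
        proof
          fix r'
          show "opair p r \<in>\<^sub>V S \<longrightarrow> opair p r' \<in>\<^sub>V S \<longrightarrow> r = r'"
          proof (rule st_all[where P = "\<lambda>r'. opair p r \<in>\<^sub>V S \<longrightarrow> opair p r' \<in>\<^sub>V S \<longrightarrow> r = r'"])
            show "dfn False True (\<lambda>_. True) (\<lambda>e. opair p r \<in>\<^sub>V S \<longrightarrow> opair p (e 0) \<in>\<^sub>V S \<longrightarrow> r = e 0)"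
              by (rule dfn_rules | simp add: stS p r)+
            fix r' :: 'v assume r': "st r'"
            show "opair p r \<in>\<^sub>V S \<longrightarrow> opair p r' \<in>\<^sub>V S \<longrightarrow> r = r'"
            proof (intro impI)
              assume *: "opair p r \<in>\<^sub>V S" "opair p r' \<in>\<^sub>V S"
              then obtain f g where fg: "p = opair f g" using S_Q[of "opair p r"] by (auto simp: Q_def mem_cart)
              then have fg': "st f" "st g" using st_opairD p by blast+
              have 1: "f \<in>\<^sub>V B" "g \<in>\<^sub>V B" "r \<in>\<^sub>V K" "r' \<in>\<^sub>V K" "apx r (\<d> (app f w) (app g w))" "apx r' (\<d> (app f w) (app g w))"
                using * S' fg fg' r r' by auto
              then have "apx r r'" using apx_trans[of r "\<d> (app f w) (app g w)" r'] apx_sym by simp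
              then show "r = r'" using apx_st_eq r r' 1 by blast
            qed
          qed
        qed
      qed
      then show "\<forall>r r'. opair p r \<in>\<^sub>V S \<longrightarrow> opair p r' \<in>\<^sub>V S \<longrightarrow> r = r'" ..
    qed
    show "r = r'" if "opair p r \<in>\<^sub>V S" "opair p r' \<in>\<^sub>V S" for p r r'
      using uniq that by blast
  qed
  moreover have "st (app2 S f g) \<and> apx (app2 S f g) (\<d> (app f w) (app g w))"
    if fg: "f \<in>\<^sub>V B" "g \<in>\<^sub>V B" "st f" "st g" for f g
  proof -
    have "st (app2 S f g)" unfolding app2_def
      by (rule st_app[OF fun_S]) (simp_all add: fg stS st_opair)
    moreover have "opair (opair f g) (app2 S f g) \<in>\<^sub>V S" unfolding app2_def
      by (rule app_opair[OF fun_S]) (simp add: fg)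
    ultimately show ?thesis using S' fg by blast
  qed
  ultimately show ?thesis using stS by (intro exI[of _ S]) simp
qed

text \<open>\<open>D_ex\<close> provides a candidate for the description in \<open>hull_D\<close>.
  Two candidates agree at standard pairs, where both give the shadow, and hence everywhere by
  Transfer.\<close>

lemma D: "st D" "is_fun D (cart B B) K"
  "f \<in>\<^sub>V B \<Longrightarrow> g \<in>\<^sub>V B \<Longrightarrow> st f \<Longrightarrow> st g \<Longrightarrow> st (app2 D f g)"
  "f \<in>\<^sub>V B \<Longrightarrow> g \<in>\<^sub>V B \<Longrightarrow> st f \<Longrightarrow> st g \<Longrightarrow> apx (app2 D f g) (\<d> (app f w) (app g w))"
proof -
  obtain S where S: "st S" "is_fun S (cart B B) K" "\<And>f g. f \<in>\<^sub>V B \<Longrightarrow> g \<in>\<^sub>V B \<Longrightarrow> st f \<Longrightarrow> st g \<Longrightarrow>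
     st (app2 S f g) \<and> apx (app2 S f g) (\<d> (app f w) (app g w))"
    using D_ex by auto
  have S_K: "app2 S f g \<in>\<^sub>V K" if "f \<in>\<^sub>V B" "g \<in>\<^sub>V B" for f g
    unfolding app2_def by (rule app_mem[OF S(2)]) (simp add: that)
  then have sh: "app2 S f g = sh R (\<d> (app f w) (app g w))" if "f \<in>\<^sub>V B" "g \<in>\<^sub>V B" "st f" "st g" for f g
    using sh_eq[of "\<d> (app f w) (app g w)" "app2 S f g"] S(3) that by simp
  have "D = S" unfolding D_def hull_D_def B_def[symmetric]
  proof (rule the_equality)
    show "st S \<and> is_fun S (cart B B) K \<and> (\<forall>f\<in>elts B. \<forall>g\<in>elts B. st f \<and> st g \<longrightarrow> app2 S f g = sh R (\<d> (app f w) (app g w)))"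
      using S sh by simp
    fix T assume T: "st T \<and> is_fun T (cart B B) K \<and> (\<forall>f\<in>elts B. \<forall>g\<in>elts B. st f \<and> st g \<longrightarrow> app2 T f g = sh R (\<d> (app f w) (app g w)))"
    show "T = S"
    proof (rule fun_eqI)
      show "is_fun T (cart B B) K" "is_fun S (cart B B) K" using T S by simp_all
      fix p assume p: "p \<in>\<^sub>V cart B B"
      show "app T p = app S p"
      proof (rule st_ball[where P = "\<lambda>p. app T p = app S p", OF _ _ _ p])
        show "st (cart B B)" by (simp add: st_cart hull_B)
        show "dfn False True (\<lambda>e. e 0 \<in>\<^sub>V cart B B) (\<lambda>e. app T (e 0) = app S (e 0))"
          by (rule dfn_rules dtm_app | simp add: T S defined_at[OF S(2)] defined_at[OF T[THEN conjunct2, THEN conjunct1]])+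
        show "app T p = app S p" if "st p" "p \<in>\<^sub>V cart B B" for p
        proof -
          obtain f g where fg: "p = opair f g" "f \<in>\<^sub>V B" "g \<in>\<^sub>V B" using \<open>p \<in>\<^sub>V cart B B\<close> by (auto simp: mem_cart)
          then have "st f" "st g" using st_opairD \<open>st p\<close> by blast+
          with fg sh[of f g] T show ?thesis by (simp add: app2_def)
        qed
      qed
    qed
  qed
  with S show "st D" "is_fun D (cart B B) K"
    "f \<in>\<^sub>V B \<Longrightarrow> g \<in>\<^sub>V B \<Longrightarrow> st f \<Longrightarrow> st g \<Longrightarrow> st (app2 D f g)"
    "f \<in>\<^sub>V B \<Longrightarrow> g \<in>\<^sub>V B \<Longrightarrow> st f \<Longrightarrow> st g \<Longrightarrow> apx (app2 D f g) (\<d> (app f w) (app g w))" by simp_all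
qed

section \<open>Pseudometric properties of \<open>D\<close>\<close>

abbreviation DD where "DD f g \<equiv> app2 D f g"

lemma D_K [simp]: "f \<in>\<^sub>V B \<Longrightarrow> g \<in>\<^sub>V B \<Longrightarrow> DD f g \<in>\<^sub>V K"
  unfolding app2_def by (rule app_mem[OF D(2)]) simp

lemma dtm_D: "dtm a s G t \<Longrightarrow> dtm a s G u \<Longrightarrow> (\<And>e. G e \<Longrightarrow> t e \<in>\<^sub>V B \<and> u e \<in>\<^sub>V B) \<Longrightarrow> dtm a s G (\<lambda>e. DD (t e) (u e))"
  unfolding app2_def by (intro dtm_app dtm_opair dtm_const D(1) defined_at[OF D(2)]) auto

text \<open>Carries the triangle inequality from \<open>M\<close> over to shadows. The error
  \<open>e\<close> is split into a half \<open>h\<close> for \<open>c\<close> and a quarter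
  \<open>q\<close> each for \<open>a\<close> and \<open>b\<close>; then \<open>st_le_epsilon\<close>
  removes it.\<close>

lemma apx_le:
  assumes "apx a a'" "apx b b'" "apx c c'" "c' \<preceq> a' \<oplus>R b'" "st a" "st b" "st c"
    and [simp]: "a \<in>\<^sub>V K" "b \<in>\<^sub>V K" "c \<in>\<^sub>V K" "a' \<in>\<^sub>V K" "b' \<in>\<^sub>V K" "c' \<in>\<^sub>V K"
  shows "c \<preceq> a \<oplus>R b"
proof (rule st_le_epsilon)
  fix e assume "st e" and [simp]: "e \<in>\<^sub>V K" and "\<zero>R \<prec> e"
  then obtain h where h: "st h" "h \<in>\<^sub>V K" "\<zero>R \<prec> h" "h \<oplus>R h = e" using half_lt by metis
  then obtain q where q: "st q" "q \<in>\<^sub>V K" "\<zero>R \<prec> q" "q \<oplus>R q = h" "q \<prec> h" using half_lt by metis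
  note [simp] = h(2) q(2)
  have "c \<prec> c' \<oplus>R h" using apxD[OF assms(3) h(1-3)] by simp
  also have "c' \<oplus>R h \<preceq> (a' \<oplus>R b') \<oplus>R h" using assms(4) add_le by simp
  finally (lt_le_trans) have 1: "c \<prec> (a' \<oplus>R b') \<oplus>R h" by simp
  have "a' \<oplus>R b' \<prec> (a \<oplus>R q) \<oplus>R (b \<oplus>R q)"
    using add_lt_mono apxD(2)[OF assms(1) q(1-3)] apxD(2)[OF assms(2) q(1-3)] by simp
  from add_lt[OF this, of h] have 2: "(a' \<oplus>R b') \<oplus>R h \<prec> (a \<oplus>R q) \<oplus>R (b \<oplus>R q) \<oplus>R h" by simp
  have "(a \<oplus>R q) \<oplus>R (b \<oplus>R q) \<oplus>R h = (a \<oplus>R b) \<oplus>R ((q \<oplus>R q) \<oplus>R h)"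
    by (simp add: F.a_ac)
  then show "c \<prec> a \<oplus>R b \<oplus>R e" using lt_trans[OF 1 2] h q by simp
qed (use assms in \<open>auto simp: st_add\<close>)

lemma D_nonneg: "f \<in>\<^sub>V B \<Longrightarrow> g \<in>\<^sub>V B \<Longrightarrow> \<zero>R \<preceq> DD f g"
proof (rule st_ball2[where P = "\<lambda>f g. \<zero>R \<preceq> DD f g", OF hull_B(1) hull_B(1)])
  show "dfn False True (\<lambda>e. e 0 \<in>\<^sub>V B \<and> e 1 \<in>\<^sub>V B) (\<lambda>e. \<zero>R \<preceq> DD (e 0) (e 1))"
    by (rule dtm_D dfn_R | simp add: st_zero)+
  fix f g assume fg: "st f" "st g" "f \<in>\<^sub>V B" "g \<in>\<^sub>V B"
  let ?x = "\<d> (app f w) (app g w)"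
  show "\<zero>R \<preceq> DD f g"
  proof (rule st_le_epsilon)
    fix e assume e: "st e" "e \<in>\<^sub>V K" "\<zero>R \<prec> e"
    have "?x \<prec> DD f g \<oplus>R e" using apxD[OF D(4)] fg e by blast
    then show "\<zero>R \<prec> DD f g \<oplus>R e" using le_lt_trans[of "\<zero>R" ?x "DD f g \<oplus>R e"] d_nonneg fg e by simp
  qed (use fg D in \<open>auto simp: st_zero\<close>)
qed

lemma D_sym: "f \<in>\<^sub>V B \<Longrightarrow> g \<in>\<^sub>V B \<Longrightarrow> DD f g = DD g f"
proof (rule st_ball2[where P = "\<lambda>f g. DD f g = DD g f", OF hull_B(1) hull_B(1)])
  show "dfn False True (\<lambda>e. e 0 \<in>\<^sub>V B \<and> e 1 \<in>\<^sub>V B) (\<lambda>e. DD (e 0) (e 1) = DD (e 1) (e 0))"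
    by (rule dtm_D dfn_R | simp)+
  fix f g assume fg: "st f" "st g" "f \<in>\<^sub>V B" "g \<in>\<^sub>V B"
  then have "apx (DD f g) (\<d> (app f w) (app g w))" "apx (DD g f) (\<d> (app f w) (app g w))"
    using D(4)[of f g] D(4)[of g f] d_sym[of "app f w" "app g w"] by simp_all
  then have "apx (DD f g) (DD g f)" using apx_trans apx_sym fg by (metis D_K d_K B_app_w)
  then show "DD f g = DD g f" using apx_st_eq D(3) fg by simp
qed

lemma D_tri: "f \<in>\<^sub>V B \<Longrightarrow> g \<in>\<^sub>V B \<Longrightarrow> h \<in>\<^sub>V B \<Longrightarrow> DD f h \<preceq> DD f g \<oplus>R DD g h"
proof -
  assume fg: "f \<in>\<^sub>V B" "g \<in>\<^sub>V B" and h: "h \<in>\<^sub>V B"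
  have "\<forall>h\<in>elts B. DD f h \<preceq> DD f g \<oplus>R DD g h"
  proof (rule st_ball2[where P = "\<lambda>f g. \<forall>h\<in>elts B. DD f h \<preceq> DD f g \<oplus>R DD g h", OF hull_B(1) hull_B(1) fg])
    show "dfn False True (\<lambda>e. e 0 \<in>\<^sub>V B \<and> e 1 \<in>\<^sub>V B) (\<lambda>e. \<forall>h\<in>elts B. DD (e 0) h \<preceq> DD (e 0) (e 1) \<oplus>R DD (e 1) h)"
      by (rule dtm_D dfn_R | simp add: hull_B)+
    fix f g assume fg: "st f" "st g" "f \<in>\<^sub>V B" "g \<in>\<^sub>V B"
    have "DD f h \<preceq> DD f g \<oplus>R DD g h" if h: "h \<in>\<^sub>V B" for h
    proof (rule st_ball[where P = "\<lambda>h. DD f h \<preceq> DD f g \<oplus>R DD g h", OF _ hull_B(1) _ h])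
      show "dfn False True (\<lambda>e. e 0 \<in>\<^sub>V B) (\<lambda>e. DD f (e 0) \<preceq> DD f g \<oplus>R DD g (e 0))"
        by (rule dtm_D dfn_R | simp add: fg)+
      show "DD f h \<preceq> DD f g \<oplus>R DD g h" if h: "st h" "h \<in>\<^sub>V B" for h
        using apx_le[OF D(4) D(4) D(4) d_tri] fg h D(3) by simp
    qed
    then show "\<forall>h\<in>elts B. DD f h \<preceq> DD f g \<oplus>R DD g h" by simp
  qed
  then show ?thesis using h by simp
qed

text \<open>On standard pairs, membership in \<open>E\<close> says that the distance at
  \<open>w\<close> is infinitesimal, that is, that its shadow is zero; Transfer extends this to all
  pairs.\<close>

lemma E_iff: "f \<in>\<^sub>V B \<Longrightarrow> g \<in>\<^sub>V B \<Longrightarrow> opair f g \<in>\<^sub>V E \<longleftrightarrow> DD f g = \<zero>R"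
proof -
  have "dfn True False (\<lambda>e. e 0 \<in>\<^sub>V cart B B)
     (\<lambda>e. \<exists>f\<in>elts B. \<exists>g\<in>elts B. e 0 = opair f g \<and> apx (\<d> (app f w) (app g w)) \<zero>R)"
    by (rule dfn_apx dtm_d dtm_app dfn_R | simp add: defined_w[OF B_fun])+
  then have "dfn True False (\<lambda>e. e 0 \<in>\<^sub>V cart B B)
     (\<lambda>e. \<exists>f g. e 0 = opair f g \<and> approx R (\<d> (app f w) (app g w)) \<zero>R)"
    by (rule dfn_cong) (auto simp: mem_cart approx_iff)
  note E' = standardization[OF this]
  have E: "st E" "st t \<Longrightarrow> t \<in>\<^sub>V E \<longleftrightarrow> t \<in>\<^sub>V cart B B \<and> (\<exists>f g. t = opair f g \<and> approx R (\<d> (app f w) (app g w)) \<zero>R)" for t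
    using E' by (simp_all add: E_def hull_E_def B_def)
  assume "f \<in>\<^sub>V B" "g \<in>\<^sub>V B"
  then show ?thesis
  proof (rule st_ball2[where P = "\<lambda>f g. opair f g \<in>\<^sub>V E \<longleftrightarrow> DD f g = \<zero>R", OF hull_B(1) hull_B(1)])
    show "dfn False True (\<lambda>e. e 0 \<in>\<^sub>V B \<and> e 1 \<in>\<^sub>V B) (\<lambda>e. opair (e 0) (e 1) \<in>\<^sub>V E \<longleftrightarrow> DD (e 0) (e 1) = \<zero>R)"
      by (rule dtm_D dfn_R | simp add: st_zero E)+
    fix f g assume fg: "st f" "st g" "f \<in>\<^sub>V B" "g \<in>\<^sub>V B"
    let ?x = "\<d> (app f w) (app g w)"
    have "opair f g \<in>\<^sub>V E \<longleftrightarrow> apx ?x \<zero>R" using E(2)[of "opair f g"] fg by (auto simp: st_opair approx_iff)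
    also have "\<dots> \<longleftrightarrow> DD f g = \<zero>R"
    proof
      assume "apx ?x \<zero>R"
      then have "apx (DD f g) \<zero>R" using apx_trans[OF D(4)] fg by simp
      then show "DD f g = \<zero>R" using apx_st_eq D(3) fg st_zero by simp
    next
      assume "DD f g = \<zero>R" then show "apx ?x \<zero>R" using D(4)[of f g] fg apx_sym by simp
    qed
    finally show "opair f g \<in>\<^sub>V E \<longleftrightarrow> DD f g = \<zero>R" .
  qed
qed

lemma D_refl: "f \<in>\<^sub>V B \<Longrightarrow> DD f f = \<zero>R"
proof -
  assume f: "f \<in>\<^sub>V B"
  show ?thesis
  proof (rule st_ball[where P = "\<lambda>f. DD f f = \<zero>R", OF _ hull_B(1) _ f])
    show "dfn False True (\<lambda>e. e 0 \<in>\<^sub>V B) (\<lambda>e. DD (e 0) (e 0) = \<zero>R)"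
      by (rule dtm_D dfn_R | simp add: st_zero)+
    fix f assume f: "st f" "f \<in>\<^sub>V B"
    then have "apx (DD f f) \<zero>R" using D(4)[of f f] d_eq_0[of "app f w" "app f w"] by simp
    then show "DD f f = \<zero>R" using apx_st_eq D(3) f st_zero by simp
  qed
qed

section \<open>Completeness of the space of representatives\<close>

lemma seq_B: "is_fun F N B \<Longrightarrow> n \<in>\<^sub>V N \<Longrightarrow> app F n \<in>\<^sub>V B"
  and seq_B_defined: "is_fun F N B \<Longrightarrow> n \<in>\<^sub>V N \<Longrightarrow> defined_at F n"
  using app_mem defined_at by blast+

lemma B_defined: "f \<in>\<^sub>V B \<Longrightarrow> n \<in>\<^sub>V N \<Longrightarrow> defined_at f n"
  using B_fun defined_at by blast

lemma recip:
  assumes "i \<in>\<^sub>V N"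
  shows "\<exists>t. t \<in>\<^sub>V K \<and> t \<otimes>R (i \<oplus>R \<one>R) = \<one>R"
    and "t \<in>\<^sub>V K \<Longrightarrow> t \<otimes>R (i \<oplus>R \<one>R) = \<one>R \<Longrightarrow> \<zero>R \<prec> t"
    and "t \<in>\<^sub>V K \<Longrightarrow> t \<otimes>R (i \<oplus>R \<one>R) = \<one>R \<Longrightarrow> st i \<Longrightarrow> st t"
proof -
  have pos: "\<zero>R \<prec> i \<oplus>R \<one>R"
    using le_lt_trans[OF nat_nonneg lt_suc, of i] assms by simp
  then have nz: "i \<oplus>R \<one>R \<noteq> \<zero>R" using lt_irrefl by auto
  have K: "i \<oplus>R \<one>R \<in>\<^sub>V K" using assms by simp
  show "\<exists>t. t \<in>\<^sub>V K \<and> t \<otimes>R (i \<oplus>R \<one>R) = \<one>R" using inv_mem[OF K nz] inv_mult[OF K nz] by blast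
  assume t: "t \<in>\<^sub>V K" "t \<otimes>R (i \<oplus>R \<one>R) = \<one>R"
  then show "\<zero>R \<prec> t" using mult_one_pos K pos by blast
  assume "st i"
  then have "st (inv\<^bsub>ring_of R\<^esub> (i \<oplus>R \<one>R))" using st_inv[OF _ K nz] st_add st_one assms by simp
  moreover have "inv\<^bsub>ring_of R\<^esub> (i \<oplus>R \<one>R) = t"
    using F.inv_char[of "i \<oplus>R \<one>R" t] F.m_comm[of "i \<oplus>R \<one>R" t] t K by simp
  ultimately show "st t" by simp
qed

lemma st_Cauchy_converges:
  assumes F: "is_fun F N B" and stF: "st F" and Cauchy: "Cauchy_in R D F"
  shows "\<exists>g\<in>elts B. converges_in R D F g"
proof -
  \<comment> \<open>\<open>t\<close> is the slack 1 / (i + 1). Describing it by a product keeps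
    \<open>C\<close> within the definability rules, which cover sums and products.\<close>
  define C where "C k n \<longleftrightarrow> (\<forall>i\<in>elts N. \<forall>j\<in>elts N. i \<preceq> j \<longrightarrow> j \<preceq> k \<longrightarrow> (\<forall>t\<in>elts K. t \<otimes>R (i \<oplus>R \<one>R) = \<one>R \<longrightarrow>
    \<d> (app (app F i) n) (app (app F j) n) \<prec> DD (app F i) (app F j) \<oplus>R t))" for k n
  note FB = seq_B[OF F]
  have stFi: "st (app F i)" if "st i" "i \<in>\<^sub>V N" for i
    using st_app[OF F] that stF by blast
  have dfn_C: "dfn False True G (\<lambda>e. C (t e) (u e))"
    if "dtm False True G t" "dtm False True G u" "\<And>e. G e \<Longrightarrow> t e \<in>\<^sub>V N \<and> u e \<in>\<^sub>V N" for G t u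
  proof (rule dfn_subst2[where P = C and H = "\<lambda>k n. k \<in>\<^sub>V N \<and> n \<in>\<^sub>V N"])
    show "dfn False True (\<lambda>e. e 0 \<in>\<^sub>V N \<and> e 1 \<in>\<^sub>V N) (\<lambda>e. C (e 0) (e 1))"
      unfolding C_def
      by (rule dtm_d dtm_D dfn_R dtm_app | simp add: stF st_nats st_R st_one FB seq_B_defined[OF F] B_defined)+
  qed (use that in auto)
  have C0: "C \<zero>R n" if n: "n \<in>\<^sub>V N" for n
    unfolding C_def
  proof (intro ballI impI)
    fix i j t assume *: "i \<in> elts N" "j \<in> elts N" "i \<preceq> j" "j \<preceq> \<zero>R" "t \<in> elts K" "t \<otimes>R (i \<oplus>R \<one>R) = \<one>R"
    then have j: "j = \<zero>R" using le_antisym[of j "\<zero>R"] nat_nonneg by simp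
    then have "i = \<zero>R" using le_antisym[of i "\<zero>R"] nat_nonneg * by simp
    moreover have "\<zero>R \<prec> t" using recip(2)[of i t] * by simp
    ultimately show "\<d> (app (app F i) n) (app (app F j) n) \<prec> DD (app F i) (app F j) \<oplus>R t"
      using j n * d_eq_0[of "app (app F \<zero>R) n" "app (app F \<zero>R) n"] D_refl[of "app F \<zero>R"] FB[of "\<zero>R"] by simp
  qed
  \<comment> \<open>Otherwise goodness would pass from every \<open>k\<close> to
    \<open>k + 1\<close> and so reach \<open>k = n\<close>, which meets the first
    alternative.\<close>
  have ex: "\<exists>k\<in>elts N. C k n \<and> (k = n \<or> \<not> C (k \<oplus>R \<one>R) n)" if n: "n \<in>\<^sub>V N" for n
  proof (rule ccontr)
    assume no: "\<not> ?thesis"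
    have "C n n"
    proof (rule nat_induct[where P = "\<lambda>k. C k n", OF _ _ _ n])
      have "dfn False False (\<lambda>e. e 0 \<in>\<^sub>V N \<and> e 1 \<in>\<^sub>V N) (\<lambda>e. C (e 0) (e 1))"
        by (intro dfn_weaken_params[OF dfn_C] dtm_var) simp
      then show "dfn False False (\<lambda>e. e 0 \<in>\<^sub>V N) (\<lambda>e. C (e 0) n)"
        by (rule dfn_subst2[where P = C and H = "\<lambda>k n. k \<in>\<^sub>V N \<and> n \<in>\<^sub>V N" and t = "\<lambda>e. e 0" and u = "\<lambda>_. n"])
          (simp_all add: n dtm_var dtm_const)
      show "C \<zero>R n" by (rule C0[OF n])
      show "C (k \<oplus>R \<one>R) n" if "k \<in>\<^sub>V N" "C k n" for k using no that mem_elts by blast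
    qed
    with no n show False using mem_elts by blast
  qed
  define P where "P n y \<longleftrightarrow> (\<exists>k\<in>elts N. y = app (app F k) n \<and> C k n \<and> (k = n \<or> \<not> C (k \<oplus>R \<one>R) n))" for n y
  \<comment> \<open>\<open>w\<close> does not occur in \<open>P\<close>, and \<open>F\<close> and
    \<open>D\<close> are standard; this is why \<open>g\<close> can be chosen standard. Only
    afterwards is it evaluated at \<open>w\<close>.\<close>
  have "\<exists>g. st g \<and> is_fun g N M \<and> (\<forall>n\<in>elts N. P n (app g n))"
  proof (rule st_choice_fun)
    show "dfn False True (\<lambda>e. e 0 \<in>\<^sub>V N \<and> e 1 \<in>\<^sub>V M) (\<lambda>e. P (e 0) (e 1))"
      unfolding P_def
      by (rule dfn_C dfn_R dtm_app | simp add: stF st_nats st_R st_one FB seq_B_defined[OF F] B_defined)+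
    show "\<exists>y. y \<in>\<^sub>V M \<and> P n y" if "n \<in>\<^sub>V N" for n
      using ex[OF that] FB that unfolding P_def by (metis B_app mem_elts)
  qed (simp_all add: st_nats st_M)
  then obtain g where g: "st g" "is_fun g N M" "P w (app g w)" using w_N by auto
  then obtain k where k: "k \<in>\<^sub>V N" "app g w = app (app F k) w" "C k w" "k = w \<or> \<not> C (k \<oplus>R \<one>R) w"
    unfolding P_def by auto
  have "\<not> st k"
  proof
    assume "st k"
    then have "st (k \<oplus>R \<one>R)" using st_add[of k "\<one>R"] k st_one by simp
    \<comment> \<open>All indices up to a standard number are standard. There \<open>D\<close> is
      the shadow of the distance at \<open>w\<close>, and the standard positive \<open>t\<close>
      exceeds the infinitesimal error.\<close>
    have "C (k \<oplus>R \<one>R) w" unfolding C_def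
    proof (intro ballI impI)
      fix i j t assume *: "i \<in> elts N" "j \<in> elts N" "i \<preceq> j" "j \<preceq> k \<oplus>R \<one>R" "t \<in> elts K" "t \<otimes>R (i \<oplus>R \<one>R) = \<one>R"
      have "st j" using nat_le_st[of "k \<oplus>R \<one>R" j] * \<open>st (k \<oplus>R \<one>R)\<close> k by simp
      moreover from this have "st i" using nat_le_st[of j i] * by simp
      ultimately have "apx (DD (app F i) (app F j)) (\<d> (app (app F i) w) (app (app F j) w))"
        using D(4) FB stFi * by simp
      then show "\<d> (app (app F i) w) (app (app F j) w) \<prec> DD (app F i) (app F j) \<oplus>R t"
        using apxD(2) recip(2)[of i t] recip(3)[of i t] * \<open>st i\<close> by simp
    qed
    with k \<open>st k\<close> w_not_st show False by auto
  qed
  then have le_k: "i \<preceq> k" if "st i" "i \<in>\<^sub>V N" for i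
    using that nat_le_st[of i k] not_lt[of k i] k lt_imp_le by auto
  have gw: "app g w \<in>\<^sub>V M" using app_w g by blast
  \<comment> \<open>Goodness of \<open>k\<close> is used with \<open>j = k\<close>. The bound
    \<open>c\<close> reaches the nonstandard index \<open>k\<close> because \<open>k\<close> lies
    beyond the standard threshold \<open>i\<close>.\<close>
  have est: "\<d> (app (app F i) w) (app g w) \<prec> c \<oplus>R t"
    if i: "st i" "i \<in>\<^sub>V N" and t: "t \<in>\<^sub>V K" "t \<otimes>R (i \<oplus>R \<one>R) = \<one>R"
      and c: "c \<in>\<^sub>V K" "\<forall>m\<in>elts N. \<forall>n\<in>elts N. i \<preceq> m \<and> i \<preceq> n \<longrightarrow> DD (app F m) (app F n) \<prec> c" for i t c
  proof -
    have "\<d> (app (app F i) w) (app g w) \<prec> DD (app F i) (app F k) \<oplus>R t"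
      using k(1,3) le_k[OF i] i t unfolding k(2) C_def by simp
    moreover have "DD (app F i) (app F k) \<oplus>R t \<prec> c \<oplus>R t"
      using add_lt[of _ c t] c t le_k[OF i] i k FB by simp
    ultimately show ?thesis
      using lt_trans[of "\<d> (app (app F i) w) (app g w)" "DD (app F i) (app F k) \<oplus>R t" "c \<oplus>R t"]
        FB i k(1) t c gw by simp
  qed
  \<comment> \<open>Transfer makes the threshold standard, while \<open>m\<close> and
    \<open>n\<close> still range over all of \<open>N\<close>, including \<open>k\<close>.\<close>
  have st_Cauchy: "\<exists>i. st i \<and> i \<in>\<^sub>V N \<and> (\<forall>m\<in>elts N. \<forall>n\<in>elts N. i \<preceq> m \<and> i \<preceq> n \<longrightarrow> DD (app F m) (app F n) \<prec> c)"
    if c: "st c" "c \<in>\<^sub>V K" "\<zero>R \<prec> c" for c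
  proof -
    from Cauchy c obtain i where
      "i \<in>\<^sub>V N" "\<forall>m\<in>elts N. \<forall>n\<in>elts N. i \<preceq> m \<and> i \<preceq> n \<longrightarrow> DD (app F m) (app F n) \<prec> c"
      unfolding Cauchy_in_def by auto
    then show ?thesis
      by (intro st_bex) (rule dtm_D dfn_R dtm_app | simp add: stF st_nats c FB seq_B_defined[OF F])+
  qed
  have gB: "g \<in>\<^sub>V B"
  proof -
    \<comment> \<open>Only finiteness of \<open>app g w\<close> is wanted, so the crude tolerance 1
      is enough to keep it at limited distance from the finite point
      \<open>app (app F i) w\<close>.\<close>
    obtain i where i: "st i" "i \<in>\<^sub>V N" "\<forall>m\<in>elts N. \<forall>n\<in>elts N. i \<preceq> m \<and> i \<preceq> n \<longrightarrow> DD (app F m) (app F n) \<prec> \<one>R"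
      using st_Cauchy[of "\<one>R"] st_one zero_lt_one by auto
    obtain t where t: "t \<in>\<^sub>V K" "t \<otimes>R (i \<oplus>R \<one>R) = \<one>R" using recip(1)[OF i(2)] by blast
    let ?x = "app (app F i) w" and ?y = "app g w"
    have Fi: "app F i \<in>\<^sub>V B" "st (app F i)" using FB[OF i(2)] stFi[OF i(1,2)] by simp_all
    have x: "?x \<in>\<^sub>V M" using Fi by simp
    have "finite_point R M d ?x" using hull_B(2)[OF Fi(2)] Fi(1) by blast
    then obtain p b where p: "p \<in>\<^sub>V M" "st p" "b \<in>\<^sub>V K" "st b" "\<d> ?x p \<prec> b"
      unfolding finite_point_iff[OF x] by auto
    have "\<d> ?x ?y \<prec> \<one>R \<oplus>R t" by (rule est[OF i(1,2) t _ i(3)]) simp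
    then have "\<d> ?y ?x \<prec> \<one>R \<oplus>R t" unfolding d_sym[OF gw x] .
    then have "\<d> ?y ?x \<oplus>R \<d> ?x p \<prec> \<one>R \<oplus>R t \<oplus>R b"
      by (rule add_lt_mono[OF _ p(5)]) (use p x t gw in simp_all)
    moreover have "\<d> ?y p \<preceq> \<d> ?y ?x \<oplus>R \<d> ?x p" by (rule d_tri[OF gw x p(1)])
    ultimately have "\<d> ?y p \<prec> \<one>R \<oplus>R t \<oplus>R b"
      using le_lt_trans[of "\<d> ?y p" "\<d> ?y ?x \<oplus>R \<d> ?x p"] p Fi t gw by simp
    moreover have "st (\<one>R \<oplus>R t \<oplus>R b)" using recip(3)[OF i(2) t i(1)] st_one p t by (simp add: st_add)
    ultimately have "finite_point R M d ?y" unfolding finite_point_iff[OF gw]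
      using p t by (intro bexI[of _ p] conjI bexI[of _ "\<one>R \<oplus>R t \<oplus>R b"]) simp_all
    then show ?thesis using hull_B(2) g by simp
  qed
  have "converges_in R D F g"
    unfolding converges_in_def
  proof
    fix \<epsilon> assume "\<epsilon> \<in> elts K"
    then have "\<epsilon> \<in>\<^sub>V K" by simp
    then show "\<zero>R \<prec> \<epsilon> \<longrightarrow> (\<exists>k\<in>elts N. \<forall>n\<in>elts N. k \<preceq> n \<longrightarrow> DD (app F n) g \<prec> \<epsilon>)"
    proof (rule st_ball[where P = "\<lambda>\<epsilon>. \<zero>R \<prec> \<epsilon> \<longrightarrow> (\<exists>k\<in>elts N. \<forall>n\<in>elts N. k \<preceq> n \<longrightarrow> DD (app F n) g \<prec> \<epsilon>)", rotated 3])
      show "dfn False True (\<lambda>e. e 0 \<in>\<^sub>V K) (\<lambda>e. \<zero>R \<prec> e 0 \<longrightarrow> (\<exists>k\<in>elts N. \<forall>n\<in>elts N. k \<preceq> n \<longrightarrow> DD (app F n) g \<prec> e 0))"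
        by (rule dtm_D dfn_R dtm_app | simp add: stF st_nats st_zero g gB FB seq_B_defined[OF F])+
      show "st K" by (rule st_R)
      fix \<epsilon> assume e: "st \<epsilon>" "\<epsilon> \<in>\<^sub>V K"
      show "\<zero>R \<prec> \<epsilon> \<longrightarrow> (\<exists>k\<in>elts N. \<forall>n\<in>elts N. k \<preceq> n \<longrightarrow> DD (app F n) g \<prec> \<epsilon>)"
      proof
        assume "\<zero>R \<prec> \<epsilon>"
        \<comment> \<open>Half of \<epsilon> pays for replacing \<open>D\<close> by the distance at
          \<open>w\<close>, and two quarters for \<open>est\<close>: \<open>c = q\<close> from the
          Cauchy property and \<open>t \<prec> q\<close> from a large index.\<close>
        with e obtain h where h: "st h" "h \<in>\<^sub>V K" "\<zero>R \<prec> h" "h \<oplus>R h = \<epsilon>" using half_lt by metis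
        then obtain q where q: "st q" "q \<in>\<^sub>V K" "\<zero>R \<prec> q" "q \<oplus>R q = h" using half_lt by metis
        obtain i where i: "st i" "i \<in>\<^sub>V N" "\<forall>m\<in>elts N. \<forall>n\<in>elts N. i \<preceq> m \<and> i \<preceq> n \<longrightarrow> DD (app F m) (app F n) \<prec> q"
          using st_Cauchy q by blast
        have q0: "q \<noteq> \<zero>R" using q lt_irrefl by auto
        define u where "u = inv\<^bsub>ring_of R\<^esub> q"
        have u: "u \<in>\<^sub>V K" "st u" "\<zero>R \<prec> u" "u \<otimes>R q = \<one>R"
          using inv_mem[OF _ q0] inv_pos st_inv[OF _ _ q0] inv_mult[OF _ q0] q by (simp_all add: u_def)
        obtain v where v: "v \<in>\<^sub>V K" "st v" "i \<preceq> v" "u \<preceq> v"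
          using lt_total[of i u] i u lt_imp_le le_refl nats_K by metis
        \<comment> \<open>Beyond \<open>l\<close> both demands are met: the Cauchy bound holds past
          \<open>i\<close>, and an index above \<open>u = 1 / q\<close> makes the slack smaller than
          \<open>q\<close>.\<close>
        obtain l where l: "st l" "l \<in>\<^sub>V N" "v \<prec> l" using st_archimedean v by blast
        have il: "i \<preceq> l" "u \<prec> l" using le_lt_trans[of i v l] le_lt_trans[of u v l] lt_imp_le i u v l by simp_all
        \<comment> \<open>\<open>est\<close> and the shadow property of \<open>D\<close> speak of
          standard indices; since \<open>l\<close>, \<open>g\<close> and \<epsilon> are standard,
          Transfer covers the other \<open>n\<close>.\<close>
        have "l \<preceq> n \<longrightarrow> DD (app F n) g \<prec> \<epsilon>" if n: "n \<in>\<^sub>V N" for n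
        proof (rule st_ball[where P = "\<lambda>n. l \<preceq> n \<longrightarrow> DD (app F n) g \<prec> \<epsilon>", OF _ st_nats _ n])
          show "dfn False True (\<lambda>e. e 0 \<in>\<^sub>V N) (\<lambda>e. l \<preceq> e 0 \<longrightarrow> DD (app F (e 0)) g \<prec> \<epsilon>)"
            by (rule dtm_D dfn_R dtm_app | simp add: stF st_nats l e g gB FB seq_B_defined[OF F])+
          fix n assume n: "st n" "n \<in>\<^sub>V N"
          show "l \<preceq> n \<longrightarrow> DD (app F n) g \<prec> \<epsilon>"
          proof
            assume ln: "l \<preceq> n"
            have le: "i \<preceq> n" using le_trans[OF il(1) ln] i l n by simp
            have tail: "\<forall>m\<in>elts N. \<forall>m'\<in>elts N. n \<preceq> m \<and> n \<preceq> m' \<longrightarrow> DD (app F m) (app F m') \<prec> q"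
            proof (intro ballI impI)
              fix m m' assume m: "m \<in> elts N" "m' \<in> elts N" "n \<preceq> m \<and> n \<preceq> m'"
              then have "i \<preceq> m" "i \<preceq> m'" using le_trans[OF le, of m] le_trans[OF le, of m'] i n by simp_all
              then show "DD (app F m) (app F m') \<prec> q" using i m by simp
            qed
            obtain t where t: "t \<in>\<^sub>V K" "t \<otimes>R (n \<oplus>R \<one>R) = \<one>R" using recip(1)[OF n(2)] by blast
            have "u \<prec> n" using lt_le_trans[OF il(2) ln] u l n by simp
            then have "u \<prec> n \<oplus>R \<one>R" using lt_trans[OF _ lt_suc, of u n] u n by simp
            then have "t \<prec> q" using mult_one_lt[of t "n \<oplus>R \<one>R" u q] t u q n by simp
            then have "q \<oplus>R t \<prec> h" using add_lt'[of t q q] t q by simp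
            let ?x = "\<d> (app (app F n) w) (app g w)"
            have x: "?x \<in>\<^sub>V K" using FB n gw by simp
            have "?x \<prec> h" using lt_trans[OF est[OF n t q(2) tail] \<open>q \<oplus>R t \<prec> h\<close>] x q t h by simp
            then have "?x \<oplus>R h \<prec> \<epsilon>" using add_lt[of ?x h h] x h by simp
            moreover have "DD (app F n) g \<prec> ?x \<oplus>R h"
              using apxD(1)[OF D(4) h(1-3)] FB stFi n g gB by simp
            ultimately show "DD (app F n) g \<prec> \<epsilon>"
              using lt_trans[of "DD (app F n) g" "?x \<oplus>R h" \<epsilon>] FB n gB x h e by simp
          qed
        qed
        then show "\<exists>k\<in>elts N. \<forall>n\<in>elts N. k \<preceq> n \<longrightarrow> DD (app F n) g \<prec> \<epsilon>"
          using l by (intro bexI[of _ l]) simp_all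
      qed
    qed
  qed
  with gB show ?thesis by auto
qed

lemma Cauchy_converges:
  assumes "is_fun F N B" "Cauchy_in R D F"
  shows "\<exists>g\<in>elts B. converges_in R D F g"
proof -
  have "Cauchy_in R D F \<longrightarrow> (\<exists>g\<in>elts B. converges_in R D F g)"
  proof (rule st_ball[where A = "funs N B" and P = "\<lambda>F. Cauchy_in R D F \<longrightarrow> (\<exists>g\<in>elts B. converges_in R D F g)"])
    show "dfn False True (\<lambda>e. e 0 \<in>\<^sub>V funs N B)
      (\<lambda>e. Cauchy_in R D (e 0) \<longrightarrow> (\<exists>g\<in>elts B. converges_in R D (e 0) g))"
      unfolding Cauchy_in_def converges_in_def
      by (rule dtm_D dfn_R dtm_app | simp add: st_nats st_R st_zero hull_B(1) funs_mem seq_B seq_B_defined)+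
  qed (use assms st_Cauchy_converges in \<open>auto simp: funs_mem st_funs st_nats hull_B(1)\<close>)
  then show ?thesis using assms by blast
qed

section \<open>The quotient\<close>

definition cls where "cls f = hull_class R M d w f"
definition H where "H = hull_space R M d w"
definition HD where "HD = hull_dist R M d w"

lemma mem_cls: "f \<in>\<^sub>V B \<Longrightarrow> g \<in>\<^sub>V cls f \<longleftrightarrow> g \<in>\<^sub>V B \<and> DD f g = \<zero>R"
proof -
  assume f: "f \<in>\<^sub>V B"
  have "dfn False False (\<lambda>e. e 0 \<in>\<^sub>V B) (\<lambda>e. opair f (e 0) \<in>\<^sub>V E)"
    by (rule dfn_rules | simp)+
  from separation[OF this] obtain S where "elts S = {g. g \<in>\<^sub>V B \<and> opair f g \<in>\<^sub>V E}" by blast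
  then have "elts S = {g \<in> elts B. opair f g \<in>\<^sub>V E}" by simp
  from mem_vset[OF this, of g] show ?thesis using E_iff[OF f, of g]
    by (auto simp: cls_def hull_class_def B_def E_def)
qed

text \<open>Moving a representative within its class adds only a zero summand in the triangle
  inequality.\<close>

lemma D_cong_le:
  assumes "f \<in>\<^sub>V B" "f' \<in>\<^sub>V B" "g \<in>\<^sub>V B" "g' \<in>\<^sub>V B" "DD f f' = \<zero>R" "DD g g' = \<zero>R"
  shows "DD f g \<preceq> DD f' g'"
proof -
  have "DD f g \<preceq> DD f' g" using D_tri[of f f' g] assms by simp
  moreover have "DD f' g \<preceq> DD f' g'" using D_tri[of f' g' g] D_sym[of g' g] assms by simp
  ultimately show ?thesis using le_trans assms by simp
qed

lemma D_cong:
  assumes "f \<in>\<^sub>V B" "f' \<in>\<^sub>V B" "g \<in>\<^sub>V B" "g' \<in>\<^sub>V B" "DD f f' = \<zero>R" "DD g g' = \<zero>R"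
  shows "DD f g = DD f' g'"
proof -
  have "DD f' f = \<zero>R" using D_sym[OF assms(2,1)] assms(5) by (rule trans)
  moreover have "DD g' g = \<zero>R" using D_sym[OF assms(4,3)] assms(6) by (rule trans)
  ultimately have "DD f' g' \<preceq> DD f g" by (intro D_cong_le assms)
  moreover have "DD f g \<preceq> DD f' g'" by (rule D_cong_le) (rule assms)+
  ultimately show ?thesis by (intro le_antisym D_K assms)
qed

lemma cls_eq_iff: "f \<in>\<^sub>V B \<Longrightarrow> g \<in>\<^sub>V B \<Longrightarrow> cls f = cls g \<longleftrightarrow> DD f g = \<zero>R"
proof
  assume fg: "f \<in>\<^sub>V B" "g \<in>\<^sub>V B" "cls f = cls g"
  then have "g \<in>\<^sub>V cls f" using mem_cls[of g g] D_refl by simp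
  then show "DD f g = \<zero>R" using mem_cls[of f g] fg(1) by blast
next
  assume fg: "f \<in>\<^sub>V B" "g \<in>\<^sub>V B" "DD f g = \<zero>R"
  show "cls f = cls g"
  proof (rule set_ext)
    fix h show "h \<in>\<^sub>V cls f \<longleftrightarrow> h \<in>\<^sub>V cls g"
      using fg D_cong[of f g h h] D_refl[of h] by (auto simp: mem_cls)
  qed
qed

text \<open>The flag \<open>s\<close> is \<open>False\<close>: on the quotient, Separation and
  choice do the work, and both accept arbitrary parameters.\<close>

lemma dtm_cls:
  assumes "dtm a False G t" "\<And>e. G e \<Longrightarrow> t e \<in>\<^sub>V B"
  shows "dtm a False G (\<lambda>e. cls (t e))"
proof -
  have *: "z = cls f \<longleftrightarrow> (\<forall>g. g \<in>\<^sub>V z \<longleftrightarrow> g \<in>\<^sub>V B \<and> opair f g \<in>\<^sub>V E)" if "f \<in>\<^sub>V B" for z f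
    using set_ext[of z "cls f"] mem_cls[OF that] E_iff[OF that] by auto
  have "dfn a False (\<lambda>e. e 1 \<in>\<^sub>V B) (\<lambda>e. \<forall>g. g \<in>\<^sub>V e 0 \<longleftrightarrow> g \<in>\<^sub>V B \<and> opair (e 1) g \<in>\<^sub>V E)"
    by (rule dfn_rules | simp)+
  then have "dfn a False (\<lambda>e. e 1 \<in>\<^sub>V B) (\<lambda>e. e 0 = cls (e 1))"
    by (rule dfn_cong) (use * in auto)
  then show ?thesis unfolding dtm_def
    by (rule dfn_subst2[where H = "\<lambda>_ x. x \<in>\<^sub>V B" and P = "\<lambda>z x. z = cls x", OF _ dtm_var dtm_shift[OF assms(1)]])
      (rule assms(2))
qed

lemma mem_H: "c \<in>\<^sub>V H \<longleftrightarrow> (\<exists>f\<in>elts B. c = cls f)"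
proof -
  obtain P where P: "elts P = {x. elts x \<subseteq> elts B}" using Power by blast
  have "dfn False False (\<lambda>e. e 0 \<in>\<^sub>V P) (\<lambda>e. \<exists>f\<in>elts B. e 0 = cls f)"
    by (rule dtm_cls dfn_rules | simp)+
  from separation[OF this] obtain S where S: "elts S = {c. c \<in>\<^sub>V P \<and> (\<exists>f\<in>elts B. c = cls f)}" by blast
  have "cls f \<in>\<^sub>V P" if "f \<in>\<^sub>V B" for f
  proof -
    have "elts (cls f) \<subseteq> elts B" using mem_cls[OF that] by auto
    then show ?thesis using P by (auto simp flip: mem_elts)
  qed
  then have "elts S = cls ` elts B" unfolding S by auto
  from mem_vset[OF this, of c] show ?thesis by (auto simp: H_def hull_space_def cls_def B_def)
qed

lemma cls_H [simp]: "f \<in>\<^sub>V B \<Longrightarrow> cls f \<in>\<^sub>V H"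
  by (auto simp: mem_H)

lemma mem_HD: "t \<in>\<^sub>V HD \<longleftrightarrow> (\<exists>f g. f \<in>\<^sub>V B \<and> g \<in>\<^sub>V B \<and> t = opair (opair (cls f) (cls g)) (DD f g))"
proof -
  have "dfn False False (\<lambda>e. e 0 \<in>\<^sub>V cart (cart H H) K)
    (\<lambda>e. \<exists>f\<in>elts B. \<exists>g\<in>elts B. e 0 = opair (opair (cls f) (cls g)) (DD f g))"
    by (rule dtm_cls dtm_D dfn_rules | simp)+
  from separation[OF this] obtain S where
    S: "elts S = {t. t \<in>\<^sub>V cart (cart H H) K \<and> (\<exists>f\<in>elts B. \<exists>g\<in>elts B. t = opair (opair (cls f) (cls g)) (DD f g))}" by blast
  have "opair (opair (cls f) (cls g)) (DD f g) \<in>\<^sub>V cart (cart H H) K" if "f \<in>\<^sub>V B" "g \<in>\<^sub>V B" for f g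
    using that by simp
  then have "elts S = {opair (opair (cls f) (cls g)) (DD f g) | f g. f \<in>\<^sub>V B \<and> g \<in>\<^sub>V B}"
    unfolding S Bex_def mem_elts by blast
  from mem_vset[OF this, of t] show ?thesis
    unfolding HD_def hull_dist_def cls_def B_def D_def by blast
qed

text \<open>Single-valuedness is the independence of representatives: equal classes have
  representatives at \<open>D\<close>-distance zero, and \<open>D_cong\<close> then equates the
  values.\<close>

lemma HD: "is_fun HD (cart H H) K" "f \<in>\<^sub>V B \<Longrightarrow> g \<in>\<^sub>V B \<Longrightarrow> app2 HD (cls f) (cls g) = DD f g"
proof -
  show 1: "is_fun HD (cart H H) K"
  proof (rule is_funI)
    show "t \<in>\<^sub>V cart (cart H H) K" if "t \<in>\<^sub>V HD" for t using that by (auto simp: mem_HD)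
    show "\<exists>y. opair p y \<in>\<^sub>V HD" if p: "p \<in>\<^sub>V cart H H" for p
    proof -
      obtain f g where "f \<in>\<^sub>V B" "g \<in>\<^sub>V B" "p = opair (cls f) (cls g)" using p by (auto simp: mem_cart mem_H)
      then show ?thesis unfolding mem_HD by blast
    qed
    show "y = z" if yz: "opair p y \<in>\<^sub>V HD" "opair p z \<in>\<^sub>V HD" for p y z
    proof -
      obtain f g where f: "f \<in>\<^sub>V B" "g \<in>\<^sub>V B" "p = opair (cls f) (cls g)" "y = DD f g" using yz(1) by (auto simp: mem_HD)
      obtain f' g' where f': "f' \<in>\<^sub>V B" "g' \<in>\<^sub>V B" "p = opair (cls f') (cls g')" "z = DD f' g'"
        using yz(2) by (auto simp: mem_HD)
      have "cls f = cls f'" "cls g = cls g'" using f(3) f'(3) by simp_all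
      then have "DD f f' = \<zero>R" "DD g g' = \<zero>R" using f f' cls_eq_iff by blast+
      then show ?thesis using D_cong[of f f' g g'] f f' by simp
    qed
  qed
  assume fg: "f \<in>\<^sub>V B" "g \<in>\<^sub>V B"
  show "app2 HD (cls f) (cls g) = DD f g"
    unfolding app2_def
  proof (rule app_eqI[OF 1])
    show "opair (cls f) (cls g) \<in>\<^sub>V cart H H" using fg by simp
    show "opair (opair (cls f) (cls g)) (app D (opair f g)) \<in>\<^sub>V HD"
      unfolding mem_HD app2_def[symmetric] using fg by blast
  qed
qed

lemma HD_metric: "metric_space_in R H HD"
  unfolding metric_space_in_def using D_sym
  by (simp add: HD mem_H D_nonneg cls_eq_iff D_tri Ball_def) (auto simp: HD cls_eq_iff D_nonneg D_tri)

text \<open>Choice lifts the sequence of classes to a sequence of representatives. Since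
  \<open>cls\<close> preserves distances, the Cauchy property passes up to the representatives and
  convergence back down to the classes.\<close>

lemma H_complete:
  assumes s: "is_fun s N H" and "Cauchy_in R HD s"
  shows "\<exists>x\<in>elts H. converges_in R HD s x"
proof -
  have sH: "app s n \<in>\<^sub>V H" if "n \<in>\<^sub>V N" for n using app_mem[OF s that] .
  have "\<exists>F. is_fun F N B \<and> (\<forall>n\<in>elts N. app s n = cls (app F n))"
  proof (rule choice_fun)
    show "dfn False False (\<lambda>e. e 0 \<in>\<^sub>V N \<and> e 1 \<in>\<^sub>V B) (\<lambda>e. app s (e 0) = cls (e 1))"
      by (rule dtm_cls dfn_rules dtm_app | simp add: defined_at[OF s])+
    show "\<exists>f. f \<in>\<^sub>V B \<and> app s n = cls f" if "n \<in>\<^sub>V N" for n using sH[OF that] by (auto simp: mem_H)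
  qed
  then obtain F where F: "is_fun F N B" "\<And>n. n \<in>\<^sub>V N \<Longrightarrow> app s n = cls (app F n)" by auto
  have "Cauchy_in R D F" using assms(2) unfolding Cauchy_in_def by (simp add: F HD seq_B)
  then obtain g where g: "g \<in>\<^sub>V B" "converges_in R D F g" using Cauchy_converges[OF F(1)] by auto
  from g(2) have "converges_in R HD s (cls g)" unfolding converges_in_def by (simp add: F HD seq_B g)
  then show ?thesis using g by auto
qed

end

theorem theorem4p7:
  fixes R :: "'v::bst real_structure" and M d w :: 'v
  assumes "standard_reals R"
    and "metric_space_in R M d" and "st M" and "st d"
    and "w \<in>\<^sub>V nats R" and "\<not> limited R w"
  shows "complete_metric_space_in R (hull_space R M d w) (hull_dist R M d w)"
proof -
  interpret hull R M d w
    by (intro hull.intro bst_reals.intro hull_axioms.intro assms)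
  show ?thesis
    unfolding complete_metric_space_in_def
    using HD_metric H_complete by (simp add: H_def HD_def)
qed

end
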